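(* Let $n\ge 2$, let $B_n(\mathbb{R}P^2)$ and $P_n(\mathbb{R}P^2)$ be the braid group and pure braid group of the real projective plane on $n$ strings, and let $$a=\rho_n\sigma_{n-1}\cdots\sigma_1,\qquad b=\rho_{n-1}\sigma_{n-2}\cdots\sigma_1$$ in $B_n(\mathbb{R}P^2)$. Write $\langle\langle x\rangle\rangle$ for the normal closure of $x$ in $B_n(\mathbb{R}P^2)$. (a) The group $B_n(\mathbb{R}P^2)$ is generated by $\{a,b\}$, and $\operatorname{G}(B_n(\mathbb{R}P^2))=\operatorname{TG}(B_n(\mathbb{R}P^2))=2$. (b) The normal closure of any element of $B_n(\mathbb{R}P^2)$ is a proper subgroup of $B_n(\mathbb{R}P^2)$, and $\operatorname{NG}(B_n(\mathbb{R}P^2))=\operatorname{NTG}(B_n(\mathbb{R}P^2))=2$. In particular, $B_n(\mathbb{R}P^2)$ is not strongly $k$-torsion generated for any $k\in\mathbb{N}$. (c) The quotient of $B_n(\mathbb{R}P^2)$ by either $\langle\langle a\rangle\rangle$ or $\langle\langle b\rangle\rangle$ is isomorphic to $\mathbb{Z}_2$. (d) The group $P_n(\mathbb{R}P^2)$ is torsion generated by the following set of torsion elements of order $4$: $$Y=\{a^n,\ b^{n-1},\ a^{-1}b^{n-1}a,\ \ldots,\ a^{-(n-2)}b^{n-1}a^{n-2}\}.$$ Further, $\operatorname{G}(P_n(\mathbb{R}P^2))=\operatorname{NG}(P_n(\mathbb{R}P^2))=\operatorname{TG}(P_n(\mathbb{R}P^2))=\operatorname{NTG}(P_n(\mathbb{R}P^2))=n$.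 In particular, $P_n(\mathbb{R}P^2)$ cannot be normally generated by any subset consisting of less than $n$ elements.
   Context: For a compact connected surface $M$, $F_n(M)$ is the space of ordered $n$-tuples of distinct points of $M$, $D_n(M)=F_n(M)/S_n$, $P_n(M)=\pi_1(F_n(M))$ and $B_n(M)=\pi_1(D_n(M))$. There is a short exact sequence $1\to P_n(M)\to B_n(M)\xrightarrow{\pi}S_n\to 1$. The group $B_n(\mathbb{R}P^2)$ has a presentation (Van Buskirk) with generators $\sigma_1,\dots,\sigma_{n-1},\rho_1,\dots,\rho_n$ and relations: $\sigma_i\sigma_j=\sigma_j\sigma_i$ if $|i-j|\ge2$; $\sigma_i\sigma_{i+1}\sigma_i=\sigma_{i+1}\sigma_i\sigma_{i+1}$ for $1\le i\le n-2$; $\sigma_i\rho_j=\rho_j\sigma_i$ for $j\ne i,i+1$; $\rho_{i+1}=\sigma_i^{-1}\rho_i\sigma_i^{-1}$ for $1\le i\le n-1$; $\rho_{i+1}^{-1}\rho_i^{-1}\rho_{i+1}\rho_i=\sigma_i^2$ for $1\le i\le n-1$; $\rho_1^2=\sigma_1\sigma_2\cdots\sigma_{n-2}\sigma_{n-1}^2\sigma_{n-2}\cdots\sigma_2\sigma_1$. $P_n(\mathbb{R}P^2)$ is the kernel of the homomorphism $\pi$ to $S_n$ sending $\sigma_i$ to $(i,i+1)$ and each $\rho_j$ to the identity. For a group $\Gamma$, $\operatorname{G}(\Gamma)$ (resp. $\operatorname{NG}(\Gamma)$) is the minimal cardinality of a subset $X\subset\Gamma$ such that the subgroup generated by $X$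 (resp. the normal closure of $X$) is $\Gamma$. $\operatorname{TG}(\Gamma)$ (resp. $\operatorname{NTG}(\Gamma)$) is the minimal cardinality of a subset $X\subset\Gamma$ consisting of elements of finite order such that the subgroup generated by $X$ (resp. the normal closure of $X$) is $\Gamma$. $\Gamma$ is torsion generated by $X$ if $X$ consists of elements of finite order and generates $\Gamma$; it is normally generated by $X$ if the normal closure of $X$ is $\Gamma$. For $k\ge 2$, $\Gamma$ is strongly $k$-torsion generated if there is an element $g_k\in\Gamma$ of order $k$ whose normal closure is $\Gamma$. *)

theory Defs
  imports "HOL-Algebra.Algebra" "HOL-Library.Extended_Nat"
begin

section \<open>Groups given by generators and relations\<close>

text \<open>
  A letter is a generator together with an exponent: \<open>(x, True)\<close> stands for \<open>x\<close> and
  \<open>(x, False)\<close> for the inverse of \<open>x\<close>.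
\<close>

type_synonym 'g word = "('g \<times> bool) list"

definition words :: "'g set \<Rightarrow> 'g word set" where
  "words S = lists (S \<times> UNIV)"

definition inv_word :: "'g word \<Rightarrow> 'g word" where
  "inv_word w = rev (map (\<lambda>(x, e). (x, \<not> e)) w)"

inductive_set word_cong :: "'g set \<Rightarrow> ('g word \<times> 'g word) set \<Rightarrow> ('g word \<times> 'g word) set"
  for S :: "'g set" and R :: "('g word \<times> 'g word) set"
where
  refl: "u \<in> words S \<Longrightarrow> (u, u) \<in> word_cong S R"
| sym: "(u, v) \<in> word_cong S R \<Longrightarrow> (v, u) \<in> word_cong S R"
| trans: "(u, v) \<in> word_cong S R \<Longrightarrow> (v, w) \<in> word_cong S R \<Longrightarrow> (u, w) \<in> word_cong S R"
| cancel: "u \<in> words S \<Longrightarrow> v \<in> words S \<Longrightarrow> x \<in> S \<Longrightarrow>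
    (u @ [(x, e), (x, \<not> e)] @ v, u @ v) \<in> word_cong S R"
| relation: "u \<in> words S \<Longrightarrow> v \<in> words S \<Longrightarrow> (l, r) \<in> R \<Longrightarrow> l \<in> words S \<Longrightarrow> r \<in> words S \<Longrightarrow>
    (u @ l @ v, u @ r @ v) \<in> word_cong S R"

definition word_class :: "'g set \<Rightarrow> ('g word \<times> 'g word) set \<Rightarrow> 'g word \<Rightarrow> 'g word set" where
  "word_class S R w = word_cong S R `` {w}"

text \<open>The group with generating set \<open>S\<close> and relations \<open>l = r\<close> for \<open>(l, r) \<in> R\<close>.\<close>

definition presented_group ::
  "'g set \<Rightarrow> ('g word \<times> 'g word) set \<Rightarrow> 'g word set monoid" where
  "presented_group S R =
    \<lparr> carrier = words S // word_cong S R,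
      monoid.mult = (\<lambda>A B. \<Union>u\<in>A. \<Union>v\<in>B. word_class S R (u @ v)),
      one = word_class S R [] \<rparr>"

lemma words_append [simp]: "u @ v \<in> words S \<longleftrightarrow> u \<in> words S \<and> v \<in> words S"
  by (auto simp: words_def)

lemma words_Nil [simp]: "[] \<in> words S"
  by (auto simp: words_def)

lemma words_Cons [simp]: "(x, e) # w \<in> words S \<longleftrightarrow> x \<in> S \<and> w \<in> words S"
  by (auto simp: words_def)

lemma inv_word_in_words [simp]: "w \<in> words S \<Longrightarrow> inv_word w \<in> words S"
  by (fastforce simp: words_def inv_word_def)

lemma word_cong_words: "(u, v) \<in> word_cong S R \<Longrightarrow> u \<in> words S \<and> v \<in> words S"
  by (induction rule: word_cong.induct) auto

lemma equiv_word_cong: "equiv (words S) (word_cong S R)"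
proof (rule equivI)
  show "word_cong S R \<subseteq> words S \<times> words S" using word_cong_words by fast
  show "refl_on (words S) (word_cong S R)" by (auto simp: refl_on_def intro: word_cong.refl)
  show "Relation.sym (word_cong S R)" by (rule symI) (rule word_cong.sym)
  show "Relation.trans (word_cong S R)" by (rule transI) (rule word_cong.trans)
qed

lemma word_cong_context:
  "(u, v) \<in> word_cong S R \<Longrightarrow> p \<in> words S \<Longrightarrow> q \<in> words S \<Longrightarrow>
    (p @ u @ q, p @ v @ q) \<in> word_cong S R"
proof (induction rule: word_cong.induct)
  case (cancel u v x e)
  then show ?case using word_cong.cancel[of "p @ u" S "v @ q" x e R] by simp
next
  case (relation u v l r)
  then show ?case using word_cong.relation[of "p @ u" S "v @ q" l r R] by simp
next
  case (refl u)
  then show ?case by (intro word_cong.refl) simp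
next
  case (sym u v)
  then show ?case by (intro word_cong.sym[of "p @ u @ q"]) simp
next
  case (trans u v w)
  then show ?case using word_cong.trans[of "p @ u @ q" "p @ v @ q" S R "p @ w @ q"] by simp
qed

lemma word_cong_append:
  assumes "(u, u') \<in> word_cong S R" "(v, v') \<in> word_cong S R"
  shows "(u @ v, u' @ v') \<in> word_cong S R"
proof -
  have "(u @ v, u' @ v) \<in> word_cong S R"
    using word_cong_context[OF assms(1), of "[]" v] word_cong_words[OF assms(2)] by simp
  moreover have "(u' @ v, u' @ v') \<in> word_cong S R"
    using word_cong_context[OF assms(2), of u' "[]"] word_cong_words[OF assms(1)] by simp
  ultimately show ?thesis by (rule word_cong.trans)
qed

lemma word_class_eq_iff:
  "u \<in> words S \<Longrightarrow> v \<in> words S \<Longrightarrow>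
    word_class S R u = word_class S R v \<longleftrightarrow> (u, v) \<in> word_cong S R"
  unfolding word_class_def by (rule eq_equiv_class_iff[OF equiv_word_cong])

lemma carrier_presented_group: "carrier (presented_group S R) = word_class S R ` words S"
  by (auto simp: presented_group_def word_class_def quotient_def)

lemma mult_presented_group:
  assumes "u \<in> words S" "v \<in> words S"
  shows "word_class S R u \<otimes>\<^bsub>presented_group S R\<^esub> word_class S R v = word_class S R (u @ v)"
proof -
  have "word_class S R (x @ y) = word_class S R (u @ v)"
    if "x \<in> word_class S R u" "y \<in> word_class S R v" for x y
  proof -
    have c: "(u, x) \<in> word_cong S R" "(v, y) \<in> word_cong S R"
      using that by (auto simp: word_class_def)
    then have "(x @ y, u @ v) \<in> word_cong S R"
      by (intro word_cong_append word_cong.sym[of u] word_cong.sym[of v])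
    then show ?thesis
      using word_class_eq_iff[of "x @ y" S "u @ v" R] word_cong_words[of "x @ y" "u @ v" S R] by blast
  qed
  moreover have "u \<in> word_class S R u" "v \<in> word_class S R v"
    using assms by (auto simp: word_class_def intro: word_cong.refl)
  ultimately have "(\<Union>x\<in>word_class S R u. \<Union>y\<in>word_class S R v. word_class S R (x @ y)) =
      word_class S R (u @ v)"
    by blast
  then show ?thesis
    by (simp add: presented_group_def)
qed

lemma word_cong_inv: "w \<in> words S \<Longrightarrow> (inv_word w @ w, []) \<in> word_cong S R"
proof (induction w)
  case Nil
  then show ?case by (simp add: inv_word_def word_cong.refl)
next
  case (Cons a w)
  obtain x e where a: "a = (x, e)" by (cases a)
  have "(inv_word w @ [(x, \<not> e), (x, \<not> \<not> e)] @ w, inv_word w @ w) \<in> word_cong S R"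
    using Cons.prems a by (intro word_cong.cancel) auto
  then show ?case
    using Cons a word_cong.trans[of "inv_word (a # w) @ a # w" "inv_word w @ w" S R "[]"]
    by (simp add: inv_word_def)
qed

lemma group_presented_group: "group (presented_group S R)"
proof (rule groupI)
  fix x assume "x \<in> carrier (presented_group S R)"
  then obtain w where w: "w \<in> words S" "x = word_class S R w"
    by (auto simp: carrier_presented_group)
  have "word_class S R (inv_word w) \<otimes>\<^bsub>presented_group S R\<^esub> x = word_class S R []"
    using w word_cong_inv[OF w(1), of R]
    by (simp add: mult_presented_group word_class_eq_iff)
  moreover have "word_class S R (inv_word w) \<in> carrier (presented_group S R)"
    using w by (simp add: carrier_presented_group)
  moreover have "\<one>\<^bsub>presented_group S R\<^esub> = word_class S R []"
    by (simp add: presented_group_def)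
  ultimately show "\<exists>y\<in>carrier (presented_group S R).
      y \<otimes>\<^bsub>presented_group S R\<^esub> x = \<one>\<^bsub>presented_group S R\<^esub>"
    by metis
next
  have one: "\<one>\<^bsub>presented_group S R\<^esub> = word_class S R []"
    by (simp add: presented_group_def)
  show "\<one>\<^bsub>presented_group S R\<^esub> \<in> carrier (presented_group S R)"
    by (auto simp: one carrier_presented_group)
  fix x assume "x \<in> carrier (presented_group S R)"
  then show "\<one>\<^bsub>presented_group S R\<^esub> \<otimes>\<^bsub>presented_group S R\<^esub> x = x"
    by (auto simp: one carrier_presented_group mult_presented_group)
next
  fix x y assume "x \<in> carrier (presented_group S R)" "y \<in> carrier (presented_group S R)"
  then obtain u v where "u \<in> words S" "v \<in> words S" "x = word_class S R u" "y = word_class S R v"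
    by (auto simp: carrier_presented_group)
  note uv = this
  then show "x \<otimes>\<^bsub>presented_group S R\<^esub> y \<in> carrier (presented_group S R)"
    by (simp add: carrier_presented_group mult_presented_group)
  fix z assume "z \<in> carrier (presented_group S R)"
  then obtain w where "w \<in> words S" "z = word_class S R w"
    by (auto simp: carrier_presented_group)
  with uv show "x \<otimes>\<^bsub>presented_group S R\<^esub> y \<otimes>\<^bsub>presented_group S R\<^esub> z =
      x \<otimes>\<^bsub>presented_group S R\<^esub> (y \<otimes>\<^bsub>presented_group S R\<^esub> z)"
    by (simp add: mult_presented_group)
qed


section \<open>The braid groups of the projective plane\<close>

datatype braid_gen = Sig nat | Rho nat

abbreviation sig :: "nat \<Rightarrow> braid_gen word" where "sig i \<equiv> [(Sig i, True)]"
abbreviation rho :: "nat \<Rightarrow> braid_gen word" where "rho j \<equiv> [(Rho j, True)]"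

definition braid_gens :: "nat \<Rightarrow> braid_gen set" where
  "braid_gens n = Sig ` {1..<n} \<union> Rho ` {1..n}"

text \<open>
  Van Buskirk's relations. In the last one,
  \<open>concat (map sig [1..<n]) @ concat (map sig (rev [1..<n]))\<close> is the word
  \<open>\<sigma>\<^sub>1 \<dots> \<sigma>\<^sub>n\<^sub>-\<^sub>2 \<sigma>\<^sub>n\<^sub>-\<^sub>1 \<sigma>\<^sub>n\<^sub>-\<^sub>1 \<sigma>\<^sub>n\<^sub>-\<^sub>2 \<dots> \<sigma>\<^sub>1\<close>.
\<close>

definition braid_rels :: "nat \<Rightarrow> (braid_gen word \<times> braid_gen word) set" where
  "braid_rels n =
     {(sig i @ sig j, sig j @ sig i) | i j.
        i \<in> {1..<n} \<and> j \<in> {1..<n} \<and> 2 \<le> \<bar>int i - int j\<bar>}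
   \<union> {(sig i @ sig (i + 1) @ sig i, sig (i + 1) @ sig i @ sig (i + 1)) | i.
        1 \<le> i \<and> i + 2 \<le> n}
   \<union> {(sig i @ rho j, rho j @ sig i) | i j.
        i \<in> {1..<n} \<and> j \<in> {1..n} \<and> j \<noteq> i \<and> j \<noteq> i + 1}
   \<union> {(rho (i + 1), inv_word (sig i) @ rho i @ inv_word (sig i)) | i. i \<in> {1..<n}}
   \<union> {(inv_word (rho (i + 1)) @ inv_word (rho i) @ rho (i + 1) @ rho i, sig i @ sig i) | i.
        i \<in> {1..<n}}
   \<union> {(rho 1 @ rho 1, concat (map sig [1..<n]) @ concat (map sig (rev [1..<n])))}"

definition braid_group :: "nat \<Rightarrow> braid_gen word set monoid" where
  "braid_group n = presented_group (braid_gens n) (braid_rels n)"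

definition braid :: "nat \<Rightarrow> braid_gen word \<Rightarrow> braid_gen word set" where
  "braid n w = word_class (braid_gens n) (braid_rels n) w"

text \<open>
  The homomorphism to \<open>S\<^sub>n\<close> on words. The exponents can be ignored because transpositions are
  involutions.
\<close>

fun word_perm :: "braid_gen word \<Rightarrow> nat \<Rightarrow> nat" where
  "word_perm [] = id"
| "word_perm ((Sig i, e) # w) = transpose i (i + 1) \<circ> word_perm w"
| "word_perm ((Rho j, e) # w) = word_perm w"

definition braid_perm :: "braid_gen word set \<Rightarrow> nat \<Rightarrow> nat" where
  "braid_perm c = the_elem (word_perm ` c)"

definition pure_braid_group :: "nat \<Rightarrow> braid_gen word set monoid" where
  "pure_braid_group n =
    (braid_group n)\<lparr>carrier := kernel (braid_group n) (sym_group n) braid_perm\<rparr>"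

lemma group_braid_group: "group (braid_group n)"
  by (simp add: braid_group_def group_presented_group)

lemma word_perm_append: "word_perm (u @ v) = word_perm u \<circ> word_perm v"
  by (induction u rule: word_perm.induct) (auto simp: comp_assoc)

lemma word_perm_cong:
  "(u, v) \<in> word_cong (braid_gens n) (braid_rels n) \<Longrightarrow> word_perm u = word_perm v"
proof (induction rule: word_cong.induct)
  case (cancel u v x e)
  then show ?case by (cases x) (auto simp: word_perm_append)
next
  case (relation u v l r)
  have pal: "word_perm (concat (map sig xs)) \<circ> word_perm (concat (map sig (rev xs))) = id" for xs
    by (induction xs) (auto simp: word_perm_append fun_eq_iff)
  have far: "transpose i (i + 1) \<circ> transpose j (j + 1) = transpose j (j + 1) \<circ> transpose i (i + 1)"
    if "2 \<le> \<bar>int i - int j\<bar>" for i j :: nat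
  proof -
    have "i \<noteq> j" "i \<noteq> j + 1" "j \<noteq> i + 1" using that by auto
    then show ?thesis by (intro ext) (simp add: transpose_def)
  qed
  have braid: "transpose i (i + 1) \<circ> (transpose (i + 1) (i + 2) \<circ> transpose i (i + 1)) =
      transpose (i + 1) (i + 2) \<circ> (transpose i (i + 1) \<circ> transpose (i + 1) (i + 2))" for i :: nat
    by (intro ext) (simp add: transpose_def)
  from relation(3) have "word_perm l = word_perm r"
    unfolding braid_rels_def
  proof (elim UnE CollectE exE conjE insertE emptyE Pair_inject)
    fix i j assume "l = sig i @ sig j" "r = sig j @ sig i" "2 \<le> \<bar>int i - int j\<bar>"
    then show ?thesis using far[of i j] by simp
  next
    fix i assume "l = sig i @ sig (i + 1) @ sig i" "r = sig (i + 1) @ sig i @ sig (i + 1)"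
    then show ?thesis using braid[of i] by simp
  next
    assume "l = rho 1 @ rho 1"
      "r = concat (map sig [1..<n]) @ concat (map sig (rev [1..<n]))"
    then show ?thesis using pal[of "[1..<n]"] by (simp add: word_perm_append)
  qed (simp_all add: inv_word_def)
  then show ?case by (simp add: word_perm_append)
qed auto

lemma braid_perm_braid:
  assumes "w \<in> words (braid_gens n)"
  shows "braid_perm (braid n w) = word_perm w"
proof -
  have "w \<in> braid n w"
    using word_cong.refl[OF assms] by (simp add: braid_def word_class_def)
  moreover have "word_perm v = word_perm w" if "v \<in> braid n w" for v
  proof -
    have "(w, v) \<in> word_cong (braid_gens n) (braid_rels n)"
      using that by (simp add: braid_def word_class_def)
    then show ?thesis by (rule word_perm_cong[symmetric])
  qed
  ultimately have "word_perm ` braid n w = {word_perm w}"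
    by (intro equalityI subsetI) (blast, blast)
  then show ?thesis by (simp add: braid_perm_def)
qed

lemma word_perm_permutes: "w \<in> words (braid_gens n) \<Longrightarrow> word_perm w permutes {1..n}"
proof (induction w rule: word_perm.induct)
  case 1
  show ?case unfolding word_perm.simps by (rule permutes_id)
next
  case (2 i e w)
  then have "i \<in> {1..n}" "i + 1 \<in> {1..n}" "word_perm w permutes {1..n}"
    by (auto simp: braid_gens_def)
  then show ?case
    unfolding word_perm.simps by (intro permutes_compose permutes_swap_id)
next
  case (3 j e w)
  then show ?case by simp
qed

lemma braid_perm_hom: "braid_perm \<in> hom (braid_group n) (sym_group n)"
proof (rule homI)
  fix x assume "x \<in> carrier (braid_group n)"
  then obtain u where u: "u \<in> words (braid_gens n)" "x = braid n u"
    by (auto simp: braid_group_def carrier_presented_group braid_def)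
  then show "braid_perm x \<in> carrier (sym_group n)"
    using word_perm_permutes[of u n] by (simp add: braid_perm_braid sym_group_def)
  fix y assume "y \<in> carrier (braid_group n)"
  then obtain v where v: "v \<in> words (braid_gens n)" "y = braid n v"
    by (auto simp: braid_group_def carrier_presented_group braid_def)
  have "x \<otimes>\<^bsub>braid_group n\<^esub> y = braid n (u @ v)"
    using u v by (simp add: braid_group_def braid_def mult_presented_group)
  then show "braid_perm (x \<otimes>\<^bsub>braid_group n\<^esub> y) =
      braid_perm x \<otimes>\<^bsub>sym_group n\<^esub> braid_perm y"
    using u v by (simp add: braid_perm_braid word_perm_append sym_group_def)
qed

definition elem_a :: "nat \<Rightarrow> braid_gen word set" where
  "elem_a n = braid n (rho n @ concat (map sig (rev [1..<n])))"

definition elem_b :: "nat \<Rightarrow> braid_gen word set" where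
  "elem_b n = braid n (rho (n - 1) @ concat (map sig (rev [1..<n - 1])))"


section \<open>Generating sets and normal generating sets\<close>

definition normal_closure :: "('a, 'm) monoid_scheme \<Rightarrow> 'a set \<Rightarrow> 'a set" where
  "normal_closure G A = \<Inter>{N. N \<lhd> G \<and> A \<subseteq> N}"

definition generated_by :: "('a, 'm) monoid_scheme \<Rightarrow> 'a set \<Rightarrow> bool" where
  "generated_by G A \<longleftrightarrow> A \<subseteq> carrier G \<and> generate G A = carrier G"

definition normally_generated_by :: "('a, 'm) monoid_scheme \<Rightarrow> 'a set \<Rightarrow> bool" where
  "normally_generated_by G A \<longleftrightarrow> A \<subseteq> carrier G \<and> normal_closure G A = carrier G"

text \<open>\<^const>\<open>group.ord\<close> is \<open>0\<close> exactly on the elements of infinite order.\<close>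

definition torsion_set :: "('a, 'm) monoid_scheme \<Rightarrow> 'a set \<Rightarrow> bool" where
  "torsion_set G A \<longleftrightarrow> (\<forall>x\<in>A. 0 < group.ord G x)"

definition torsion_generated_by :: "('a, 'm) monoid_scheme \<Rightarrow> 'a set \<Rightarrow> bool" where
  "torsion_generated_by G A \<longleftrightarrow> torsion_set G A \<and> generated_by G A"

text \<open>The least cardinality of a finite set satisfying \<open>P\<close>, and \<open>\<infinity>\<close> if there is none.\<close>

definition min_card :: "('a set \<Rightarrow> bool) \<Rightarrow> enat" where
  "min_card P = (INF A\<in>{A. finite A \<and> P A}. enat (card A))"

definition G_rank :: "('a, 'm) monoid_scheme \<Rightarrow> enat" where
  "G_rank G = min_card (generated_by G)"

definition NG_rank :: "('a, 'm) monoid_scheme \<Rightarrow> enat" where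
  "NG_rank G = min_card (normally_generated_by G)"

definition TG_rank :: "('a, 'm) monoid_scheme \<Rightarrow> enat" where
  "TG_rank G = min_card (torsion_generated_by G)"

definition NTG_rank :: "('a, 'm) monoid_scheme \<Rightarrow> enat" where
  "NTG_rank G = min_card (\<lambda>A. torsion_set G A \<and> normally_generated_by G A)"

definition strongly_torsion_generated :: "nat \<Rightarrow> ('a, 'm) monoid_scheme \<Rightarrow> bool" where
  "strongly_torsion_generated k G \<longleftrightarrow>
    2 \<le> k \<and> (\<exists>g\<in>carrier G. group.ord G g = k \<and> normal_closure G {g} = carrier G)"

end

theory Submission
  imports Defs "HOL-Library.Product_Plus"
begin

text \<open>
  Everything algebraic comes from two rotations \<open>a = \<rho>\<^sub>n \<sigma>\<^sub>n\<^sub>-\<^sub>1 \<dots> \<sigma>\<^sub>1\<close> and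
  \<open>b = \<rho>\<^sub>n\<^sub>-\<^sub>1 \<sigma>\<^sub>n\<^sub>-\<^sub>2 \<dots> \<sigma>\<^sub>1\<close>. Conjugation by \<open>a\<close> shifts the generators cyclically,
  \<open>\<sigma>\<^sub>i \<mapsto> \<sigma>\<^sub>i\<^sub>+\<^sub>1\<close> and \<open>\<rho>\<^sub>i \<mapsto> \<rho>\<^sub>i\<^sub>+\<^sub>1\<close>, where the cycle closes up with a reversal of orientation:
  \<open>\<rho>\<^sub>n \<mapsto> \<rho>\<^sub>1\<^sup>-\<^sup>1\<close>, and \<open>\<sigma>\<^sub>n\<^sub>-\<^sub>1\<close> goes to \<open>\<sigma>\<^sub>1\<^sup>-\<^sup>1\<close> under \<open>a\<^sup>2\<close>. So \<open>W = a\<^sup>n\<close> inverts every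
  generator by conjugation (\<open>r_W_r\<close>, \<open>s_W_s\<close>), and \<open>z = W\<^sup>2\<close> is central. Since
  \<open>b = \<sigma>\<^sub>n\<^sub>-\<^sub>1 a\<close>, the two rotations generate the group.

  Comparing powers of \<open>a\<close> and \<open>b\<close> gives \<open>W = \<rho>\<^sub>n b\<^sup>n\<^sup>-\<^sup>1 = \<rho>\<^sub>n \<dots> \<rho>\<^sub>1\<close>, hence
  \<open>b\<^sup>2\<^sup>(\<^sup>n\<^sup>-\<^sup>1\<^sup>) = z\<close>. Moreover \<open>z = (\<sigma>\<^sub>n\<^sub>-\<^sub>1 \<dots> \<sigma>\<^sub>1)\<^sup>n\<close>, and conjugation by \<open>W\<close> turns this into
  \<open>z\<^sup>-\<^sup>1 = (\<sigma>\<^sub>1 \<dots> \<sigma>\<^sub>n\<^sub>-\<^sub>1)\<^sup>n\<close>. The two products of the \<open>\<sigma>\<close>'s are conjugate, so the central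
  elements \<open>z\<close> and \<open>z\<^sup>-\<^sup>1\<close> agree and \<open>z\<^sup>2 = 1\<close> (\<open>W_W_square\<close>). That \<open>z \<noteq> 1\<close> is
  seen in an action by quaternions: for each ordered pair of strings, \<open>\<rho>\<close> of the first string
  acts as \<open>i\<close>, \<open>\<rho>\<close> of the second as \<open>j\<close>, and a crossing of the two as \<open>k\<close>; then \<open>z\<close>
  acts as \<open>-1\<close> (\<open>quat_full_twist\<close>). This settles all orders.

  The pure braid group is the subgroup generated by the \<open>\<rho>\<close>'s (\<open>pure_braid_group_eq\<close>): that
  subgroup contains the \<open>\<sigma>\<^sub>i\<^sup>2\<close> and is normalized by the \<open>\<sigma>\<^sub>i\<close>, and modulo it the \<open>\<sigma>\<^sub>i\<close>
  satisfy the Coxeter relations, which present the symmetric group. Up to inversion and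
  multiplication by \<open>W\<close> the elements of \<open>Y\<close> are the \<open>\<rho>\<close>'s, so \<open>Y\<close> generates it.

  The lower bounds come from homomorphisms to \<open>\<int>\<^sub>2\<close>, which are blind to conjugation: \<open>k\<close> of
  them that are independent force every normal generating set to have at least \<open>k\<close> elements
  (\<open>card_normal_generators_ge\<close>). The whole group has two, counting the \<open>\<sigma>\<close>'s and the
  \<open>\<rho>\<close>'s; the pure group has \<open>n\<close>, the \<open>j\<close>-th telling whether the path of the \<open>j\<close>-th point in
  the projective plane is non-contractible. Finally the relation \<open>b a\<^sup>n\<^sup>-\<^sup>1 b = a\<^sup>n\<^sup>+\<^sup>1\<close>
  puts \<open>b\<^sup>2\<close> into the normal closure of \<open>a\<close> and \<open>a\<^sup>2\<close> into that of \<open>b\<close>, so that both quotients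
  in question have at most two elements; a suitable homomorphism to \<open>\<int>\<^sub>2\<close> shows that they are
  not trivial.

  The algebra is done in an arbitrary group with elements satisfying Van Buskirk's relations
  (the locale \<open>projective_braids\<close>). This serves the braid group itself and, by its universal
  property (\<open>braid_group_hom\<close>), every group to which homomorphisms are constructed.
\<close>

section \<open>Products of consecutive elements and generated subgroups\<close>

text \<open>
  The number \<open>l\<close> of factors is an argument of its own because also the partial products
  \<open>f m, f m f (m - 1), \<dots>\<close> are needed: they occur in the powers of rotations and as coset
  representatives.
\<close>

primrec descending :: "('a, 'm) monoid_scheme \<Rightarrow> (nat \<Rightarrow> 'a) \<Rightarrow> nat \<Rightarrow> nat \<Rightarrow> 'a" where
  "descending G f m 0 = \<one>\<^bsub>G\<^esub>"
| "descending G f m (Suc l) = descending G f m l \<otimes>\<^bsub>G\<^esub> f (m - l)"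

primrec ascending :: "('a, 'm) monoid_scheme \<Rightarrow> (nat \<Rightarrow> 'a) \<Rightarrow> nat \<Rightarrow> 'a" where
  "ascending G f 0 = \<one>\<^bsub>G\<^esub>"
| "ascending G f (Suc m) = ascending G f m \<otimes>\<^bsub>G\<^esub> f (Suc m)"

context monoid
begin

lemma descending_closed: "(\<And>i. f i \<in> carrier G) \<Longrightarrow> descending G f m l \<in> carrier G"
  by (induction l) auto

lemma ascending_closed: "(\<And>i. f i \<in> carrier G) \<Longrightarrow> ascending G f m \<in> carrier G"
  by (induction m) auto

lemma descending_Suc_left:
  assumes "\<And>i. f i \<in> carrier G"
  shows "descending G f (Suc m) (Suc l) = f (Suc m) \<otimes> descending G f m l"
  using assms by (induction l) (auto simp: m_assoc descending_closed)

lemma descending_commute: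
  assumes "\<And>i. f i \<in> carrier G" "x \<in> carrier G"
    and "\<And>i. m - l < i \<Longrightarrow> i \<le> m \<Longrightarrow> x \<otimes> f i = f i \<otimes> x" and "l \<le> m"
  shows "x \<otimes> descending G f m l = descending G f m l \<otimes> x"
  using assms(3,4)
proof (induction l)
  case 0
  then show ?case using assms(1,2) by simp
next
  case (Suc l)
  then have "x \<otimes> descending G f m l = descending G f m l \<otimes> x"
    by (intro Suc.IH) auto
  moreover have "x \<otimes> f (m - l) = f (m - l) \<otimes> x"
    using Suc.prems by auto
  ultimately show ?case
    using assms(1,2) by (simp add: m_assoc[symmetric] descending_closed)
      (simp add: m_assoc descending_closed)
qed

lemma pow_intertwine:
  assumes "c \<in> carrier G" "x \<in> carrier G" "y \<in> carrier G" "c \<otimes> x = y \<otimes> c"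
  shows "c \<otimes> x [^] (k :: nat) = y [^] k \<otimes> c"
  using assms
proof (induction k)
  case (Suc k)
  have "c \<otimes> x [^] Suc k = (c \<otimes> x [^] k) \<otimes> x"
    using Suc.prems(1-3) by (simp add: m_assoc)
  also have "\<dots> = (y [^] k \<otimes> c) \<otimes> x"
    using Suc.IH Suc.prems(1-3) Suc.prems(4) by simp
  also have "\<dots> = y [^] k \<otimes> (c \<otimes> x)"
    using Suc.prems(1-3) by (simp add: m_assoc)
  also have "\<dots> = y [^] Suc k \<otimes> c"
    unfolding Suc.prems(4) using Suc.prems(1-3) by (simp add: m_assoc)
  finally show ?case .
qed simp

end

context group
begin

lemma inv_mult_cancel [simp]:
  "x \<in> carrier G \<Longrightarrow> y \<in> carrier G \<Longrightarrow> inv x \<otimes> (x \<otimes> y) = y"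
  "x \<in> carrier G \<Longrightarrow> y \<in> carrier G \<Longrightarrow> x \<otimes> (inv x \<otimes> y) = y"
  by (simp_all add: m_assoc[symmetric])

lemma eq_mult_inv_iff:
  "x \<in> carrier G \<Longrightarrow> y \<in> carrier G \<Longrightarrow> z \<in> carrier G \<Longrightarrow> x = y \<otimes> inv z \<longleftrightarrow> x \<otimes> z = y"
  by (metis inv_solve_right)

end

context group
begin

text \<open>
  Elements are built from the right, one generator at a time. For coset arguments this is the
  useful induction, since the standard rule of \<^const>\<open>generate\<close> splits a product at an arbitrary
  place.
\<close>

lemma generate_right_induct [consumes 2, case_names one mult mult_inv]:
  assumes "x \<in> generate G A" "A \<subseteq> carrier G"
    and "P \<one>"
    and "\<And>y a. y \<in> carrier G \<Longrightarrow> P y \<Longrightarrow> a \<in> A \<Longrightarrow> P (y \<otimes> a)"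
    and "\<And>y a. y \<in> carrier G \<Longrightarrow> P y \<Longrightarrow> a \<in> A \<Longrightarrow> P (y \<otimes> inv a)"
  shows "P x"
proof -
  have "P (y \<otimes> x)" if "y \<in> carrier G" "P y" for y
    using assms(1) that
  proof (induction arbitrary: y rule: generate.induct)
    case (eng h1 h2)
    then have "h1 \<in> carrier G" "h2 \<in> carrier G"
      using generate_in_carrier[OF assms(2)] by auto
    with eng show ?case by (simp add: m_assoc[symmetric])
  qed (use assms in auto)
  from this[OF one_closed assms(3)] show ?thesis
    using generate_in_carrier[OF assms(2,1)] by simp
qed

lemma conj_generate:
  assumes "g \<in> carrier G" "A \<subseteq> carrier G"
    and "\<And>a. a \<in> A \<Longrightarrow> g \<otimes> a \<otimes> inv g \<in> generate G A"
    and "x \<in> generate G A"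
  shows "g \<otimes> x \<otimes> inv g \<in> generate G A"
  using assms(4)
proof (induction rule: generate.induct)
  case one
  then show ?case using assms(1) by (simp add: generate.one)
next
  case (incl h)
  then show ?case by (rule assms(3))
next
  case (inv h)
  then have "inv (g \<otimes> h \<otimes> inv g) \<in> generate G A" "h \<in> carrier G"
    using assms by (auto intro: generate_m_inv_closed)
  then show ?case using assms(1) by (simp add: inv_mult_group m_assoc)
next
  case (eng h1 h2)
  then have "h1 \<in> carrier G" "h2 \<in> carrier G"
    using generate_in_carrier[OF assms(2)] by auto
  then have "g \<otimes> (h1 \<otimes> h2) \<otimes> inv g = (g \<otimes> h1 \<otimes> inv g) \<otimes> (g \<otimes> h2 \<otimes> inv g)"
    using assms(1) by (simp add: m_assoc)
  then show ?case using eng by (simp add: generate.eng)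
qed

end

section \<open>The relations in an arbitrary group\<close>

text \<open>
  Van Buskirk's relations, with inverses moved to the other side so that in a group of bijections
  they can be checked by composing maps only. The generators are total families, with arbitrary values in the group outside the range of their indices; this
  saves range conditions on closure.
\<close>

locale projective_braids = group G for G (structure) +
  fixes n :: nat and s r :: "nat \<Rightarrow> 'a"
  assumes two_le_n: "2 \<le> n"
    and s_closed [simp, intro]: "s i \<in> carrier G"
    and r_closed [simp, intro]: "r j \<in> carrier G"
    and s_far: "1 \<le> i \<Longrightarrow> i + 2 \<le> j \<Longrightarrow> j < n \<Longrightarrow> s i \<otimes> s j = s j \<otimes> s i"
    and s_braid: "1 \<le> i \<Longrightarrow> i + 2 \<le> n \<Longrightarrow> s i \<otimes> s (i + 1) \<otimes> s i = s (i + 1) \<otimes> s i \<otimes> s (i + 1)"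
    and s_r_far: "1 \<le> i \<Longrightarrow> i < n \<Longrightarrow> 1 \<le> j \<Longrightarrow> j \<le> n \<Longrightarrow> j \<noteq> i \<Longrightarrow> j \<noteq> i + 1 \<Longrightarrow>
      s i \<otimes> r j = r j \<otimes> s i"
    and s_r_s: "1 \<le> i \<Longrightarrow> i < n \<Longrightarrow> s i \<otimes> r (i + 1) \<otimes> s i = r i"
    and r_r_s_s: "1 \<le> i \<Longrightarrow> i < n \<Longrightarrow> r i \<otimes> r (i + 1) \<otimes> (s i \<otimes> s i) = r (i + 1) \<otimes> r i"
    and r_1_square: "r 1 \<otimes> r 1 = ascending G s (n - 1) \<otimes> descending G s (n - 1) (n - 1)"
begin

abbreviation desc :: "nat \<Rightarrow> nat \<Rightarrow> 'a" where "desc \<equiv> descending G s"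
abbreviation asc :: "nat \<Rightarrow> 'a" where "asc \<equiv> ascending G s"

text \<open>
  The rotation of the first \<open>m\<close> strings: \<open>a\<close> is \<open>rot n\<close> and \<open>b\<close> is \<open>rot (n - 1)\<close>.
\<close>

definition rot :: "nat \<Rightarrow> 'a" where "rot m = r m \<otimes> desc (m - 1) (m - 1)"

lemma desc_closed [simp, intro]: "desc m l \<in> carrier G"
  by (simp add: descending_closed)

lemma r_desc_closed [simp, intro]: "descending G r m l \<in> carrier G"
  by (simp add: descending_closed)

lemma asc_closed [simp, intro]: "asc m \<in> carrier G"
  by (simp add: ascending_closed)

lemma rot_closed [simp, intro]: "rot m \<in> carrier G"
  by (simp add: rot_def)

text \<open>
  The crossing commutes with all factors of the product except two neighbouring ones, and there
  one braid relation changes its index by one.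
\<close>

lemma desc_shift:
  assumes "i < m" "m < n" "m - l < i" "l \<le> m"
  shows "desc m l \<otimes> s (i + 1) = s i \<otimes> desc m l"
  using assms(3,4)
proof (induction l)
  case 0
  then show ?case using assms(1) by simp
next
  case (Suc l)
  \<comment> \<open>The new factor \<open>s (m - l)\<close> is far from \<open>s (i + 1)\<close>, or it completes the pair
    \<open>s (i + 1), s i\<close> to which the braid relation applies.\<close>
  consider "m - l < i" | "m - l = i" using Suc.prems by linarith
  then show ?case
  proof cases
    case 1
    have "desc m l \<otimes> (s (m - l) \<otimes> s (i + 1)) = desc m l \<otimes> (s (i + 1) \<otimes> s (m - l))"
      using 1 assms Suc.prems by (subst s_far) auto
    with 1 Suc show ?thesis
      by (simp add: m_assoc) (simp add: m_assoc[symmetric])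
  next
    case 2
    then obtain l' where l: "l = Suc l'" using assms(1) by (cases l) auto
    with 2 Suc.prems have l': "m - l' = i + 1" by linarith
    have c: "s i \<otimes> desc m l' = desc m l' \<otimes> s i"
      using 2 l l' assms Suc.prems by (intro descending_commute s_far) auto
    have "desc m (Suc l) \<otimes> s (i + 1) = desc m l' \<otimes> (s (i + 1) \<otimes> s i \<otimes> s (i + 1))"
      using l l' 2 by (simp add: m_assoc)
    also have "\<dots> = desc m l' \<otimes> (s i \<otimes> s (i + 1) \<otimes> s i)"
      using 2 assms Suc.prems by (subst s_braid) auto
    also have "\<dots> = (s i \<otimes> desc m l') \<otimes> (s (i + 1) \<otimes> s i)"
      unfolding c by (simp add: m_assoc)
    also have "\<dots> = s i \<otimes> desc m (Suc l)"
      using l l' 2 by (simp add: m_assoc)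
    finally show ?thesis .
  qed
qed

lemma desc_Suc_left: "desc (Suc m) (Suc l) = s (Suc m) \<otimes> desc m l"
  by (rule descending_Suc_left) simp

lemma desc_desc_shift:
  assumes "k < m" "m < n" "l \<le> k"
  shows "desc k l \<otimes> desc m m = desc m m \<otimes> desc (k + 1) l"
  using assms(3)
proof (induction l)
  case (Suc l)
  have sh: "s (k - l) \<otimes> desc m m = desc m m \<otimes> s (k - l + 1)"
    using assms Suc.prems by (subst desc_shift) auto
  have "desc k (Suc l) \<otimes> desc m m = desc k l \<otimes> (s (k - l) \<otimes> desc m m)"
    by (simp add: m_assoc)
  also have "\<dots> = (desc k l \<otimes> desc m m) \<otimes> s (k - l + 1)"
    unfolding sh by (simp add: m_assoc)
  also have "\<dots> = desc m m \<otimes> (desc (k + 1) l \<otimes> s (k + 1 - l))"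
    using Suc by (simp add: m_assoc Suc_diff_le)
  finally show ?case by simp
qed simp

text \<open>
  The \<open>\<sigma>\<close>-part of the cyclic shift closing up: with \<open>\<delta> = \<sigma>\<^sub>m \<dots> \<sigma>\<^sub>1\<close>, conjugation by
  \<open>\<delta>\<close> would send \<open>\<sigma>\<^sub>m\<close> to an extra crossing between the last and the first point, and that one
  goes to \<open>\<sigma>\<^sub>1\<close>. Two conjugations avoid the extra crossing.
\<close>

lemma desc_square_shift:
  assumes "1 \<le> m" "m < n"
  shows "desc m m \<otimes> desc m m \<otimes> s 1 = s m \<otimes> (desc m m \<otimes> desc m m)"
proof -
  have left: "desc m m = s m \<otimes> desc (m - 1) (m - 1)"
    using desc_Suc_left[of "m - 1" "m - 1"] assms by simp
  have right: "desc m m = desc m (m - 1) \<otimes> s 1"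
    using assms by (cases m) auto
  have "desc (m - 1) (m - 1) \<otimes> desc m m = desc m m \<otimes> desc m (m - 1)"
    using desc_desc_shift[of "m - 1" m "m - 1"] assms by simp
  then have "s m \<otimes> (desc (m - 1) (m - 1) \<otimes> desc m m) \<otimes> s 1 = s m \<otimes> (desc m m \<otimes> (desc m (m - 1) \<otimes> s 1))"
    by (simp add: m_assoc)
  then show ?thesis
    using left right by (simp add: m_assoc)
qed

text \<open>
  The ascending and the descending product are two Coxeter elements, hence conjugate. The
  induction moves the new factor \<open>\<sigma>\<^sub>m\<^sub>+\<^sub>1\<close> to the other end by a cyclic permutation; for this the
  previous conjugator must commute with \<open>\<sigma>\<^sub>m\<^sub>+\<^sub>1\<close>, which is why the statement says that it
  commutes with whatever commutes with \<open>\<sigma>\<^sub>1, \<dots>, \<sigma>\<^sub>m\<^sub>-\<^sub>1\<close>.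
\<close>

lemma asc_desc_conjugate:
  assumes "m < n"
  obtains g where "g \<in> carrier G" "asc m \<otimes> g = g \<otimes> desc m m"
    "\<And>x. x \<in> carrier G \<Longrightarrow> (\<And>i. 1 \<le> i \<Longrightarrow> i < m \<Longrightarrow> x \<otimes> s i = s i \<otimes> x) \<Longrightarrow> x \<otimes> g = g \<otimes> x"
proof -
  have "\<exists>g\<in>carrier G. asc m \<otimes> g = g \<otimes> desc m m \<and>
    (\<forall>x\<in>carrier G. (\<forall>i. 1 \<le> i \<longrightarrow> i < m \<longrightarrow> x \<otimes> s i = s i \<otimes> x) \<longrightarrow> x \<otimes> g = g \<otimes> x)"
    using assms
  proof (induction m)
    case 0
    then show ?case by (intro bexI[of _ \<one>]) auto
  next
    case (Suc m)
    then obtain g where g: "g \<in> carrier G" "asc m \<otimes> g = g \<otimes> desc m m"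
      "\<And>x. x \<in> carrier G \<Longrightarrow> (\<And>i. 1 \<le> i \<Longrightarrow> i < m \<Longrightarrow> x \<otimes> s i = s i \<otimes> x) \<Longrightarrow> x \<otimes> g = g \<otimes> x"
      by auto
    have sg: "s (Suc m) \<otimes> g = g \<otimes> s (Suc m)"
      using Suc.prems by (intro g(3) s_far[symmetric]) auto
    \<comment> \<open>The factor \<open>desc m m\<close> of the new conjugator performs the cyclic permutation.\<close>
    have "asc (Suc m) \<otimes> (g \<otimes> desc m m) = asc m \<otimes> (s (Suc m) \<otimes> g) \<otimes> desc m m"
      using g(1) by (simp add: m_assoc)
    also have "\<dots> = asc m \<otimes> g \<otimes> (s (Suc m) \<otimes> desc m m)"
      unfolding sg using g(1) by (simp add: m_assoc)
    also have "\<dots> = (g \<otimes> desc m m) \<otimes> desc (Suc m) (Suc m)"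
      using g(2) desc_Suc_left[of m m] by simp
    finally have 1: "asc (Suc m) \<otimes> (g \<otimes> desc m m) = (g \<otimes> desc m m) \<otimes> desc (Suc m) (Suc m)" .
    have 2: "x \<otimes> (g \<otimes> desc m m) = (g \<otimes> desc m m) \<otimes> x"
      if x: "x \<in> carrier G" "\<forall>i. 1 \<le> i \<longrightarrow> i < Suc m \<longrightarrow> x \<otimes> s i = s i \<otimes> x" for x
    proof -
      have "x \<otimes> g = g \<otimes> x" using x by (intro g(3)) auto
      moreover have "x \<otimes> desc m m = desc m m \<otimes> x"
        using x by (intro descending_commute) auto
      ultimately show ?thesis
        using x(1) g(1) by (simp add: m_assoc[symmetric]) (simp add: m_assoc)
    qed
    show ?case
      using 1 2 g(1) by (intro bexI[of _ "g \<otimes> desc m m"]) auto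
  qed
  then show thesis using that by blast
qed

text \<open>
  As \<open>\<rho>\<^sub>m\<^sub>+\<^sub>1 = \<sigma>\<^sub>m\<^sup>-\<^sup>1 \<rho>\<^sub>m \<sigma>\<^sub>m\<^sup>-\<^sup>1\<close>, the second \<open>\<sigma>\<^sub>m\<^sup>-\<^sup>1\<close> cancels against the first factor of the
  descending product. For \<open>m = n - 1\<close> this is \<open>b = \<sigma>\<^sub>n\<^sub>-\<^sub>1 a\<close>.
\<close>

lemma s_rot:
  assumes "1 \<le> m" "m < n"
  shows "s m \<otimes> rot (m + 1) = rot m"
proof -
  have d: "desc m m = s m \<otimes> desc (m - 1) (m - 1)"
    using desc_Suc_left[of "m - 1" "m - 1"] assms by simp
  have "s m \<otimes> rot (m + 1) = (s m \<otimes> r (m + 1) \<otimes> s m) \<otimes> desc (m - 1) (m - 1)"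
    by (simp add: rot_def d m_assoc)
  then show ?thesis
    using s_r_s[OF assms] by (simp add: rot_def)
qed

lemma rot_s:
  assumes "1 \<le> i" "i + 2 \<le> m" "m \<le> n"
  shows "rot m \<otimes> s (i + 1) = s i \<otimes> rot m"
proof -
  have sh: "desc (m - 1) (m - 1) \<otimes> s (i + 1) = s i \<otimes> desc (m - 1) (m - 1)"
    using assms by (intro desc_shift) auto
  have "rot m \<otimes> s (i + 1) = (r m \<otimes> s i) \<otimes> desc (m - 1) (m - 1)"
    by (simp only: rot_def m_assoc sh s_closed r_closed desc_closed)
  also have "r m \<otimes> s i = s i \<otimes> r m"
    using assms s_r_far[of i m] by simp
  finally show ?thesis by (simp add: rot_def m_assoc)
qed

lemma r_r_s:
  assumes "1 \<le> i" "i < n"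
  shows "r i \<otimes> (r (i + 1) \<otimes> s i) = r (i + 1) \<otimes> (s i \<otimes> r (i + 1))"
proof -
  have "r i \<otimes> (r (i + 1) \<otimes> s i) \<otimes> s i = r (i + 1) \<otimes> (s i \<otimes> r (i + 1) \<otimes> s i)"
    using r_r_s_s[OF assms] s_r_s[OF assms] by (simp add: m_assoc)
  then have "r i \<otimes> (r (i + 1) \<otimes> s i) \<otimes> s i = r (i + 1) \<otimes> (s i \<otimes> r (i + 1)) \<otimes> s i"
    by (simp add: m_assoc)
  then show ?thesis by (subst (asm) r_cancel) auto
qed

text \<open>
  For \<open>m = i + 1\<close> this is the commutator relation in the form \<open>r_r_s\<close>; a larger \<open>m\<close> only
  adds factors \<open>\<sigma>\<close> on the left of the rotation, by \<open>s_rot\<close>, and these commute with \<open>\<rho>\<^sub>i\<close>.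
\<close>

lemma rot_r:
  assumes "1 \<le> i" "i < m" "m \<le> n"
  shows "rot m \<otimes> r (i + 1) = r i \<otimes> rot m"
  using assms(2,3)
proof (induction m)
  case 0
  then show ?case by simp
next
  case (Suc m)
  consider "m = i" | "i < m" using Suc.prems by linarith
  then show ?case
  proof cases
    case 1
    let ?d = "desc (i - 1) (i - 1)"
    have d: "desc i i = s i \<otimes> ?d"
      using desc_Suc_left[of "i - 1" "i - 1"] assms by simp
    have c: "r (i + 1) \<otimes> ?d = ?d \<otimes> r (i + 1)"
      using 1 Suc.prems by (intro descending_commute s_r_far[symmetric]) auto
    have "rot (i + 1) \<otimes> r (i + 1) = r (i + 1) \<otimes> s i \<otimes> (?d \<otimes> r (i + 1))"
      by (simp add: rot_def d m_assoc)
    also have "\<dots> = r (i + 1) \<otimes> (s i \<otimes> r (i + 1)) \<otimes> ?d"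
      unfolding c[symmetric] by (simp add: m_assoc)
    also have "\<dots> = r i \<otimes> rot (i + 1)"
      using 1 Suc.prems assms(1) by (subst r_r_s[symmetric]) (auto simp: rot_def d m_assoc)
    finally show ?thesis using 1 by simp
  next
    case 2
    have m: "1 \<le> m" "m < n" using 2 assms(1) Suc.prems by auto
    have rot: "rot m = s m \<otimes> rot (Suc m)" using s_rot[OF m] by simp
    have c: "s m \<otimes> r i = r i \<otimes> s m" using 2 m assms(1) by (intro s_r_far) auto
    have "s m \<otimes> (rot (Suc m) \<otimes> r (i + 1)) = rot m \<otimes> r (i + 1)"
      by (simp add: rot m_assoc)
    also have "\<dots> = r i \<otimes> rot m" using Suc.IH 2 m by simp
    also have "\<dots> = (s m \<otimes> r i) \<otimes> rot (Suc m)" unfolding c by (simp add: rot m_assoc)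
    finally have "s m \<otimes> (rot (Suc m) \<otimes> r (i + 1)) = s m \<otimes> (r i \<otimes> rot (Suc m))"
      by (simp add: m_assoc)
    then show ?thesis by (subst (asm) l_cancel) auto
  qed
qed

lemma rot_pow_s:
  assumes "1 \<le> i" "i + k < m" "m \<le> n"
  shows "rot m [^] k \<otimes> s (i + k) = s i \<otimes> rot m [^] k"
  using assms(2)
proof (induction k)
  case (Suc k)
  have "rot m [^] Suc k \<otimes> s (i + Suc k) = rot m [^] k \<otimes> (rot m \<otimes> s (i + k + 1))"
    by (simp add: m_assoc)
  also have "\<dots> = rot m [^] k \<otimes> s (i + k) \<otimes> rot m"
    using assms Suc.prems by (subst rot_s) (auto simp: m_assoc)
  also have "\<dots> = s i \<otimes> rot m [^] Suc k"
    using Suc by (simp add: m_assoc)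
  finally show ?case .
qed simp

lemma rot_pow_r:
  assumes "1 \<le> i" "i + k \<le> m" "m \<le> n"
  shows "rot m [^] k \<otimes> r (i + k) = r i \<otimes> rot m [^] k"
  using assms(2)
proof (induction k)
  case (Suc k)
  have "rot m [^] Suc k \<otimes> r (i + Suc k) = rot m [^] k \<otimes> (rot m \<otimes> r (i + k + 1))"
    by (simp add: m_assoc)
  also have "\<dots> = rot m [^] k \<otimes> r (i + k) \<otimes> rot m"
    using assms Suc.prems by (subst rot_r) (auto simp: m_assoc)
  also have "\<dots> = r i \<otimes> rot m [^] Suc k"
    using Suc by (simp add: m_assoc)
  finally show ?case .
qed simp

text \<open>
  Writing \<open>rot m = \<sigma>\<^sub>m rot (m + 1)\<close> and collecting the rotations on the right lowers the index of
  \<open>\<sigma>\<^sub>m\<close> each time, so that the \<open>\<sigma>\<close>'s form a descending product. For \<open>k = m\<close> it is completed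
  by \<open>\<rho>\<^sub>m\<^sub>+\<^sub>1\<close> to one more rotation, which gives \<open>rot_pow_Suc\<close>.
\<close>

lemma rot_pow_eq_desc:
  assumes "1 \<le> m" "m < n" "k \<le> m"
  shows "rot m [^] k = desc m k \<otimes> rot (m + 1) [^] k"
  using assms(3)
proof (induction k)
  case (Suc k)
  have sh: "rot (m + 1) [^] k \<otimes> s m = s (m - k) \<otimes> rot (m + 1) [^] k"
    using rot_pow_s[of "m - k" k "m + 1"] assms Suc.prems by simp
  have "rot m [^] Suc k = desc m k \<otimes> (rot (m + 1) [^] k \<otimes> s m) \<otimes> rot (m + 1)"
    using Suc s_rot[OF assms(1,2), symmetric] by (simp add: m_assoc)
  also have "\<dots> = desc m (Suc k) \<otimes> rot (m + 1) [^] Suc k"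
    unfolding sh by (simp add: m_assoc)
  finally show ?case .
qed simp

lemma rot_pow_Suc:
  assumes "1 \<le> m" "m < n"
  shows "rot (m + 1) [^] (m + 1) = r (m + 1) \<otimes> rot m [^] m"
proof -
  have "rot (m + 1) [^] (m + 1) = rot (m + 1) \<otimes> rot (m + 1) [^] m"
    by (metis Suc_eq_plus1 nat_pow_Suc2 rot_closed)
  also have "\<dots> = r (m + 1) \<otimes> (desc m m \<otimes> rot (m + 1) [^] m)"
    by (simp add: rot_def m_assoc)
  finally show ?thesis using rot_pow_eq_desc[of m m] assms by simp
qed

lemma rot_pow_self:
  assumes "1 \<le> m" "m \<le> n"
  shows "rot m [^] m = descending G r m m"
  using assms
proof (induction m rule: dec_induct)
  case base
  then show ?case by (simp add: rot_def)
next
  case (step m)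
  then show ?case
    using rot_pow_Suc[of m] by (simp add: descending_Suc_left del: nat_pow_Suc descending.simps)
qed

lemma asc_rot:
  assumes "m < n"
  shows "asc m \<otimes> rot (m + 1) = r 1"
  using assms
proof (induction m)
  case (Suc m)
  then show ?case using s_rot[of "Suc m"] by (simp add: m_assoc)
qed (simp add: rot_def)

text \<open>
  Peeling off crossings by \<open>s_rot\<close> down to \<open>rot 1 = \<rho>\<^sub>1\<close> gives
  \<open>\<sigma>\<^sub>1 \<dots> \<sigma>\<^sub>n\<^sub>-\<^sub>1 a = \<rho>\<^sub>1\<close>; then multiply by \<open>\<rho>\<^sub>1\<close> and use the relation for \<open>\<rho>\<^sub>1\<^sup>2\<close>.
\<close>

lemma rot_r_1: "rot n \<otimes> r 1 = desc (n - 1) (n - 1)"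
proof -
  have asc: "asc (n - 1) \<otimes> rot n = r 1"
    using asc_rot[of "n - 1"] two_le_n by simp
  then have "asc (n - 1) \<otimes> (rot n \<otimes> r 1) = r 1 \<otimes> r 1"
    by (simp add: m_assoc[symmetric])
  also have "\<dots> = asc (n - 1) \<otimes> desc (n - 1) (n - 1)"
    by (rule r_1_square)
  finally show ?thesis by (subst (asm) l_cancel) auto
qed

lemma r_rot_r: "r n \<otimes> rot n \<otimes> r 1 = rot n"
  using rot_r_1 by (simp add: m_assoc) (simp add: rot_def)

text \<open>
  \<open>W\<close> is the product \<open>\<rho>\<^sub>n \<dots> \<rho>\<^sub>1\<close>, and \<open>W\<^sup>2\<close> is the full twist.
\<close>

abbreviation W :: 'a where "W \<equiv> rot n [^] n"

text \<open>
  Conjugation by \<open>a\<^sup>n\<close> moves \<open>\<rho>\<^sub>i\<close> once around the cycle, so it meets the reversal \<open>r_rot_r\<close>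
  exactly once and becomes its inverse.
\<close>

lemma r_W_r:
  assumes "1 \<le> i" "i \<le> n"
  shows "r i \<otimes> W \<otimes> r i = W"
proof -
  let ?a = "rot n"
  have split: "W = ?a [^] (n - i) \<otimes> ?a \<otimes> ?a [^] (i - 1)"
  proof -
    have "W = ?a [^] (Suc (n - i) + (i - 1))" using assms by simp
    then show ?thesis by (simp add: nat_pow_mult[symmetric] del: add_Suc)
  qed
  have 1: "r i \<otimes> ?a [^] (n - i) = ?a [^] (n - i) \<otimes> r n"
    using rot_pow_r[of i "n - i" n] assms by simp
  have 2: "?a [^] (i - 1) \<otimes> r i = r 1 \<otimes> ?a [^] (i - 1)"
    using rot_pow_r[of 1 "i - 1" n] assms by simp
  have "r i \<otimes> W \<otimes> r i = (r i \<otimes> ?a [^] (n - i)) \<otimes> ?a \<otimes> (?a [^] (i - 1) \<otimes> r i)"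
    unfolding split by (simp add: m_assoc)
  also have "\<dots> = ?a [^] (n - i) \<otimes> (r n \<otimes> ?a \<otimes> r 1) \<otimes> ?a [^] (i - 1)"
    unfolding 1 2 by (simp add: m_assoc)
  finally show ?thesis unfolding r_rot_r split by simp
qed

text \<open>
  Here \<open>a\<^sup>2 = \<rho>\<^sub>n\<^sub>-\<^sub>1 \<rho>\<^sub>n \<delta>\<^sup>2\<close> with \<open>\<delta> = \<sigma>\<^sub>n\<^sub>-\<^sub>1 \<dots> \<sigma>\<^sub>1\<close>: conjugation by \<open>\<rho>\<^sub>n\<^sub>-\<^sub>1 \<rho>\<^sub>n\<close>
  inverts \<open>\<sigma>\<^sub>n\<^sub>-\<^sub>1\<close>, and conjugation by \<open>\<delta>\<^sup>2\<close> turns it into \<open>\<sigma>\<^sub>1\<close>.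
\<close>

lemma s_rot_rot_s: "s (n - 1) \<otimes> (rot n \<otimes> rot n) \<otimes> s 1 = rot n \<otimes> rot n"
proof -
  let ?t = "s (n - 1)" and ?d = "desc (n - 1) (n - 1)"
  let ?rr = "r (n - 1) \<otimes> r n"
  have n: "n - 1 + 1 = n" "1 \<le> n - 1" "n - 1 < n" using two_le_n by auto
  have rr: "rot n \<otimes> rot n = ?rr \<otimes> (?d \<otimes> ?d)"
  proof -
    have "rot n \<otimes> rot n = (rot n \<otimes> r n) \<otimes> ?d" by (simp add: rot_def m_assoc)
    also have "rot n \<otimes> r n = r (n - 1) \<otimes> rot n"
      using rot_r[of "n - 1" n] n by simp
    finally show ?thesis by (simp add: rot_def m_assoc)
  qed
  have trt: "?t \<otimes> r n \<otimes> ?t = r (n - 1)" using s_r_s[of "n - 1"] n by simp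
  have "?t \<otimes> (r (n - 1) \<otimes> r n \<otimes> (?t \<otimes> ?t)) = ?t \<otimes> r n \<otimes> r (n - 1)"
    using r_r_s_s[of "n - 1"] n by (simp add: m_assoc)
  also have "\<dots> = (?t \<otimes> r n \<otimes> ?t) \<otimes> (r n \<otimes> ?t)"
    by (subst trt[symmetric]) (simp add: m_assoc)
  also have "\<dots> = ?rr \<otimes> ?t" unfolding trt by (simp add: m_assoc)
  finally have "(?t \<otimes> (?rr \<otimes> ?t)) \<otimes> ?t = ?rr \<otimes> ?t" by (simp add: m_assoc)
  then have t: "?t \<otimes> (?rr \<otimes> ?t) = ?rr" by (subst (asm) r_cancel) auto
  have "?t \<otimes> (rot n \<otimes> rot n) \<otimes> s 1 = ?t \<otimes> ?rr \<otimes> (?d \<otimes> ?d \<otimes> s 1)"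
    unfolding rr by (simp add: m_assoc)
  also have "\<dots> = (?t \<otimes> (?rr \<otimes> ?t)) \<otimes> (?d \<otimes> ?d)"
    using n by (subst desc_square_shift) (auto simp: m_assoc)
  finally show ?thesis unfolding t rr .
qed

lemma s_W_s:
  assumes "1 \<le> i" "i < n"
  shows "s i \<otimes> W \<otimes> s i = W"
proof -
  let ?a = "rot n"
  have split: "W = ?a [^] (n - 1 - i) \<otimes> (?a \<otimes> ?a) \<otimes> ?a [^] (i - 1)"
  proof -
    have "(n - 1 - i) + (2 + (i - 1)) = n" using assms by linarith
    then have "W = ?a [^] ((n - 1 - i) + (2 + (i - 1)))" by (simp only:)
    also have "\<dots> = ?a [^] (n - 1 - i) \<otimes> (?a [^] (2 :: nat) \<otimes> ?a [^] (i - 1))"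
      by (simp only: nat_pow_mult rot_closed)
    finally show ?thesis by (simp add: numeral_2_eq_2 m_assoc)
  qed
  have 1: "s i \<otimes> ?a [^] (n - 1 - i) = ?a [^] (n - 1 - i) \<otimes> s (n - 1)"
    using rot_pow_s[of i "n - 1 - i" n] assms by simp
  have 2: "?a [^] (i - 1) \<otimes> s i = s 1 \<otimes> ?a [^] (i - 1)"
    using rot_pow_s[of 1 "i - 1" n] assms by simp
  have "s i \<otimes> W \<otimes> s i = (s i \<otimes> ?a [^] (n - 1 - i)) \<otimes> (?a \<otimes> ?a) \<otimes> (?a [^] (i - 1) \<otimes> s i)"
    unfolding split by (simp add: m_assoc)
  also have "\<dots> = ?a [^] (n - 1 - i) \<otimes> (s (n - 1) \<otimes> (?a \<otimes> ?a) \<otimes> s 1) \<otimes> ?a [^] (i - 1)"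
    unfolding 1 2 by (simp add: m_assoc)
  finally show ?thesis unfolding s_rot_rot_s split by simp
qed

lemma inv_conj_W:
  assumes "x \<in> carrier G" "x \<otimes> W \<otimes> x = W"
  shows "x \<otimes> W = W \<otimes> inv x" "inv x \<otimes> W = W \<otimes> x" "x \<otimes> (W \<otimes> W) = W \<otimes> W \<otimes> x"
proof -
  show 1: "x \<otimes> W = W \<otimes> inv x"
    using assms by (subst eq_mult_inv_iff) auto
  have "inv x \<otimes> W = inv x \<otimes> (x \<otimes> W \<otimes> x)" using assms(2) by simp
  then show 2: "inv x \<otimes> W = W \<otimes> x" using assms(1) by (simp add: m_assoc)
  have "x \<otimes> (W \<otimes> W) = (x \<otimes> W) \<otimes> W" using assms(1) by (simp add: m_assoc)
  also have "\<dots> = W \<otimes> (inv x \<otimes> W)" unfolding 1 using assms(1) by (simp add: m_assoc)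
  also have "\<dots> = W \<otimes> W \<otimes> x" unfolding 2 using assms(1) by (simp add: m_assoc)
  finally show "x \<otimes> (W \<otimes> W) = W \<otimes> W \<otimes> x" .
qed

lemma asc_r_W: "k \<le> n \<Longrightarrow> ascending G r k \<otimes> W = W \<otimes> inv (descending G r k k)"
proof (induction k)
  case (Suc k)
  have c: "ascending G r k \<in> carrier G" by (simp add: ascending_closed)
  have "r (Suc k) \<otimes> W = W \<otimes> inv (r (Suc k))"
    using Suc.prems r_W_r by (intro inv_conj_W(1)) auto
  then have "ascending G r (Suc k) \<otimes> W = (ascending G r k \<otimes> W) \<otimes> inv (r (Suc k))"
    using c by (simp add: m_assoc)
  also have "\<dots> = W \<otimes> (inv (descending G r k k) \<otimes> inv (r (Suc k)))"
    using Suc c by (simp add: m_assoc)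
  finally show ?case
    by (simp add: descending_Suc_left inv_mult_group del: descending.simps)
qed simp

lemma desc_W: "k < n \<Longrightarrow> desc k k \<otimes> W = W \<otimes> inv (asc k)"
proof (induction k)
  case (Suc k)
  have 1: "s (Suc k) \<otimes> W = W \<otimes> inv (s (Suc k))"
    using Suc.prems s_W_s by (intro inv_conj_W(1)) auto
  have "desc (Suc k) (Suc k) \<otimes> W = s (Suc k) \<otimes> (desc k k \<otimes> W)"
    by (simp add: desc_Suc_left m_assoc del: descending.simps)
  also have "\<dots> = (s (Suc k) \<otimes> W) \<otimes> inv (asc k)"
    using Suc by (simp add: m_assoc)
  finally show ?case
    unfolding 1 by (simp add: m_assoc inv_mult_group)
qed simp

lemma rot_pow_eq_r_desc:
  "k \<le> n \<Longrightarrow> ascending G r (n - k) \<otimes> rot n [^] k = ascending G r n \<otimes> desc (n - 1) (n - 1) [^] k"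
proof (induction k)
  case (Suc k)
  let ?d = "desc (n - 1) (n - 1)"
  have asc: "ascending G r (n - k) = ascending G r (n - Suc k) \<otimes> r (n - k)"
    using Suc.prems by (metis Suc_diff_Suc Suc_le_lessD ascending.simps(2))
  have c: "ascending G r i \<in> carrier G" for i by (simp add: ascending_closed)
  have sh: "rot n [^] k \<otimes> r n = r (n - k) \<otimes> rot n [^] k"
    using rot_pow_r[of "n - k" k n] Suc.prems by simp
  have "ascending G r (n - Suc k) \<otimes> rot n [^] Suc k
      = ascending G r (n - Suc k) \<otimes> (rot n [^] k \<otimes> r n) \<otimes> ?d"
    using c by (simp add: m_assoc rot_def)
  also have "\<dots> = (ascending G r (n - k) \<otimes> rot n [^] k) \<otimes> ?d"
    unfolding sh asc using c by (simp add: m_assoc)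
  finally show ?case
    using Suc c by (simp add: m_assoc)
qed simp

text \<open>
  Pulling all \<open>\<rho>\<close>'s out of \<open>a\<^sup>n = (\<rho>\<^sub>n \<delta>)\<^sup>n\<close> to the left gives
  \<open>W = \<rho>\<^sub>1 \<dots> \<rho>\<^sub>n \<delta>\<^sup>n\<close>. Since conjugation by \<open>W\<close> inverts the \<open>\<rho>\<close>'s and
  \<open>W = \<rho>\<^sub>n \<dots> \<rho>\<^sub>1\<close>, the product in the other order is \<open>W\<^sup>-\<^sup>1\<close>.
\<close>

lemma desc_pow: "desc (n - 1) (n - 1) [^] n = W \<otimes> W"
proof -
  have c: "ascending G r n \<in> carrier G" by (simp add: ascending_closed)
  have W: "descending G r n n = W"
    using rot_pow_self[of n] two_le_n by simp
  have "ascending G r n \<otimes> W = \<one>"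
    using asc_r_W[of n] by (simp add: W)
  then have asc: "ascending G r n = inv W"
    using c by (metis inv_equality nat_pow_closed rot_closed inv_comm)
  have "W = inv W \<otimes> desc (n - 1) (n - 1) [^] n"
    using rot_pow_eq_r_desc[of n] asc by simp
  then have "W \<otimes> W = W \<otimes> (inv W \<otimes> desc (n - 1) (n - 1) [^] n)" by simp
  then show ?thesis by simp
qed

text \<open>
  Conjugating \<open>z = \<delta>\<^sup>n\<close> by \<open>W\<close> shows that \<open>z\<^sup>-\<^sup>1\<close> is the \<open>n\<close>-th power of the ascending
  product; as that one is conjugate to \<open>\<delta>\<close>, the elements \<open>z\<close> and \<open>z\<^sup>-\<^sup>1\<close> are conjugate. The
  conjugator commutes with \<open>z\<close>, because \<open>z\<close> commutes with all \<open>\<sigma>\<^sub>i\<close>.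
\<close>

lemma W_W_square: "(W \<otimes> W) \<otimes> (W \<otimes> W) = \<one>"
proof -
  let ?d = "desc (n - 1) (n - 1)" and ?a = "asc (n - 1)"
  let ?z = "W \<otimes> W"
  obtain g where g: "g \<in> carrier G" "?a \<otimes> g = g \<otimes> ?d"
    "\<And>x. x \<in> carrier G \<Longrightarrow> (\<And>i. 1 \<le> i \<Longrightarrow> i < n - 1 \<Longrightarrow> x \<otimes> s i = s i \<otimes> x) \<Longrightarrow> x \<otimes> g = g \<otimes> x"
    using asc_desc_conjugate[of "n - 1"] two_le_n by auto
  have zg: "?z \<otimes> g = g \<otimes> ?z"
  proof (rule g(3))
    show "?z \<otimes> s i = s i \<otimes> ?z" if "1 \<le> i" "i < n - 1" for i
      using inv_conj_W(3)[of "s i"] s_W_s[of i] that by simp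
  qed simp
  have "W \<otimes> inv ?a = ?d \<otimes> W"
    using desc_W[of "n - 1"] two_le_n by simp
  then have "W \<otimes> inv ?a [^] n = ?d [^] n \<otimes> W"
    by (intro pow_intertwine) auto
  also have "\<dots> = W \<otimes> ?z" by (simp only: desc_pow) (simp add: m_assoc)
  finally have "inv ?a [^] n = ?z" by simp
  then have "inv (?a [^] n) = ?z" by (simp add: nat_pow_inv)
  then have an: "?a [^] n = inv ?z" by (metis asc_closed inv_inv nat_pow_closed)
  have "g \<otimes> ?d [^] n = ?a [^] n \<otimes> g"
    by (intro pow_intertwine g(1) g(2)[symmetric]) auto
  then have "g \<otimes> ?z = inv ?z \<otimes> g" by (simp only: desc_pow an)
  then have "?z \<otimes> g = inv ?z \<otimes> g" by (simp only: zg)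
  then have z: "?z = inv ?z" by (subst (asm) r_cancel) (use g(1) in auto)
  have "?z \<otimes> inv ?z = \<one>" by (rule r_inv) simp
  then show ?thesis using z by simp
qed

lemma W_eq: "W = r n \<otimes> rot (n - 1) [^] (n - 1)"
  using rot_pow_Suc[of "n - 1"] two_le_n by simp

lemma rot_pred_pow_square: "rot (n - 1) [^] (n - 1) \<otimes> rot (n - 1) [^] (n - 1) = W \<otimes> W"
proof -
  let ?b = "rot (n - 1) [^] (n - 1)"
  have "r n \<otimes> W \<otimes> r n = W" using r_W_r two_le_n by simp
  then have 2: "inv (r n) \<otimes> W = W \<otimes> r n" by (intro inv_conj_W(2)) auto
  have "inv (r n) \<otimes> W = inv (r n) \<otimes> (r n \<otimes> ?b)" using W_eq by simp
  then have b: "?b = inv (r n) \<otimes> W" by simp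
  have "?b \<otimes> ?b = (W \<otimes> r n) \<otimes> (inv (r n) \<otimes> W)" using b 2 by simp
  then show ?thesis by (simp add: m_assoc)
qed

lemma rot_pred_eq: "rot (n - 1) = s (n - 1) \<otimes> rot n"
  using s_rot[of "n - 1"] two_le_n by simp

text \<open>
  The relation between the two rotations from which the quotients by \<open>a\<close> and by \<open>b\<close> are
  computed. It is \<open>\<sigma>\<^sub>n\<^sub>-\<^sub>1 W \<sigma>\<^sub>n\<^sub>-\<^sub>1 = W\<close> in other letters.
\<close>

lemma rot_pred_rot_pow_rot_pred: "rot (n - 1) \<otimes> rot n [^] (n - 1) \<otimes> rot (n - 1) = rot n [^] (n + 1)"
proof -
  have W: "W = rot n \<otimes> rot n [^] (n - 1)"
    using nat_pow_Suc2[of "rot n" "n - 1"] two_le_n by (simp del: nat_pow_Suc)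
  have "rot (n - 1) \<otimes> rot n [^] (n - 1) \<otimes> rot (n - 1) = (s (n - 1) \<otimes> W \<otimes> s (n - 1)) \<otimes> rot n"
    unfolding W rot_pred_eq by (simp add: m_assoc)
  also have "\<dots> = W \<otimes> rot n" using s_W_s[of "n - 1"] two_le_n by simp
  finally show ?thesis by simp
qed

end

section \<open>The subgroup generated by the \<rho>'s\<close>

context projective_braids
begin

lemma generators_in_subgroup:
  assumes "subgroup H G" "rot n \<in> H" "rot (n - 1) \<in> H"
  shows "1 \<le> i \<Longrightarrow> i < n \<Longrightarrow> s i \<in> H"
    and "1 \<le> j \<Longrightarrow> j \<le> n \<Longrightarrow> r j \<in> H"
proof -
  interpret H: subgroup H G by fact
  have s: "s i \<in> H" if "1 \<le> i" "i \<le> n - 1" for i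
    using that(2,1)
  proof (induction i rule: inc_induct)
    case base
    have "s (n - 1) = rot (n - 1) \<otimes> inv (rot n)"
      by (simp only: rot_pred_eq) (simp add: m_assoc)
    then show ?case using assms by (metis H.m_closed H.m_inv_closed)
  next
    case (step i)
    have "rot n \<otimes> s (i + 1) = s i \<otimes> rot n"
      using step two_le_n by (intro rot_s) auto
    then have "s i = rot n \<otimes> s (i + 1) \<otimes> inv (rot n)" by (simp add: m_assoc)
    then show ?case using assms step by (metis H.m_closed H.m_inv_closed Suc_eq_plus1 le_SucI)
  qed
  then show "1 \<le> i \<Longrightarrow> i < n \<Longrightarrow> s i \<in> H" by simp
  have d: "desc m l \<in> H" if "m < n" "l \<le> m" for m l
    using that(2)
  proof (induction l)
    case (Suc l)
    then show ?case using s[of "m - l"] that(1) by simp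
  qed simp
  assume "1 \<le> j" "j \<le> n"
  from this(2,1) show "r j \<in> H"
  proof (induction j rule: inc_induct)
    case base
    have "r n = rot n \<otimes> inv (desc (n - 1) (n - 1))" by (simp add: rot_def m_assoc)
    then show ?case using assms(2) d[of "n - 1" "n - 1"] two_le_n by simp
  next
    case (step j)
    then show ?case
      using s_r_s[of j] s[of j] by (metis H.m_closed Suc_eq_plus1 Suc_leI Suc_le_D diff_Suc_1 le_SucI less_Suc_eq_le)
  qed
qed

lemma rot_conj_r_n:
  assumes "1 \<le> i" "i \<le> n"
  shows "inv (rot n [^] i) \<otimes> r n \<otimes> rot n [^] i = inv (r i)"
proof -
  let ?a = "rot n"
  have a: "?a [^] i = ?a \<otimes> ?a [^] (i - 1)"
    using nat_pow_Suc2[of ?a "i - 1"] assms by simp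
  have sh: "?a [^] (i - 1) \<otimes> r i = r 1 \<otimes> ?a [^] (i - 1)"
    using rot_pow_r[of 1 "i - 1" n] assms by simp
  have "r n \<otimes> ?a [^] i \<otimes> r i = r n \<otimes> ?a \<otimes> (?a [^] (i - 1) \<otimes> r i)"
    unfolding a by (simp add: m_assoc)
  also have "\<dots> = (r n \<otimes> ?a \<otimes> r 1) \<otimes> ?a [^] (i - 1)"
    unfolding sh by (simp add: m_assoc)
  also have "\<dots> = ?a [^] i" unfolding r_rot_r a by simp
  finally have "r n \<otimes> ?a [^] i \<otimes> r i = ?a [^] i" .
  then have "r n \<otimes> ?a [^] i = ?a [^] i \<otimes> inv (r i)"
    by (subst eq_mult_inv_iff) auto
  then show ?thesis by (simp add: m_assoc)
qed

text \<open>
  The elements \<open>a\<^sup>-\<^sup>i b\<^sup>n\<^sup>-\<^sup>1 a\<^sup>i\<close>, which together with \<open>W\<close> make up the set \<open>Y\<close>. As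
  \<open>b\<^sup>n\<^sup>-\<^sup>1 = \<rho>\<^sub>n\<^sup>-\<^sup>1 W\<close>, they equal \<open>\<rho>\<^sub>i W\<close>, or \<open>\<rho>\<^sub>n\<^sup>-\<^sup>1 W\<close> for \<open>i = 0\<close>.
\<close>

definition torsion_gen :: "nat \<Rightarrow> 'a" where
  "torsion_gen i = inv (rot n [^] i) \<otimes> rot (n - 1) [^] (n - 1) \<otimes> rot n [^] i"

lemma torsion_gen_closed [simp, intro]: "torsion_gen i \<in> carrier G"
  by (simp add: torsion_gen_def)

lemma torsion_gen_eq: "torsion_gen i = inv (inv (rot n [^] i) \<otimes> r n \<otimes> rot n [^] i) \<otimes> W"
proof -
  have b: "rot (n - 1) [^] (n - 1) = inv (r n) \<otimes> W"
    using W_eq by simp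
  have "W \<otimes> rot n [^] i = rot n [^] i \<otimes> W"
    by (simp add: nat_pow_mult add.commute)
  then show ?thesis
    unfolding torsion_gen_def b by (simp add: inv_mult_group m_assoc)
qed

lemma torsion_gen_0: "torsion_gen 0 = inv (r n) \<otimes> W"
  by (simp add: torsion_gen_eq)

lemma torsion_gen_pos: "1 \<le> i \<Longrightarrow> i \<le> n \<Longrightarrow> torsion_gen i = r i \<otimes> W"
  by (simp add: torsion_gen_eq rot_conj_r_n)

lemma torsion_gen_square: "torsion_gen i \<otimes> torsion_gen i = W \<otimes> W"
proof -
  have c: "rot n [^] i \<otimes> (W \<otimes> W) = W \<otimes> W \<otimes> rot n [^] i"
    by (simp add: nat_pow_mult add.commute)
  let ?b = "rot (n - 1) [^] (n - 1)"
  have "torsion_gen i \<otimes> torsion_gen i = inv (rot n [^] i) \<otimes> (?b \<otimes> ?b \<otimes> rot n [^] i)"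
    by (simp add: torsion_gen_def m_assoc)
  then show ?thesis
    unfolding rot_pred_pow_square c[symmetric] by simp
qed

lemma descending_in_subgroup:
  assumes "subgroup H G" "\<And>i. 1 \<le> i \<Longrightarrow> i \<le> m \<Longrightarrow> r i \<in> H" "l \<le> m"
  shows "descending G r m l \<in> H"
  using assms(3)
proof (induction l)
  case 0
  then show ?case using assms(1) by (simp add: subgroup.one_closed)
next
  case (Suc l)
  then have "r (m - l) \<in> H" by (intro assms(2)) auto
  with Suc show ?case using assms(1) by (simp add: subgroup.m_closed)
qed

text \<open>
  The given elements yield all \<open>\<rho>\<^sub>j\<close> directly except \<open>\<rho>\<^sub>n\<^sub>-\<^sub>1\<close>. That one is found from
  \<open>b\<^sup>n\<^sup>-\<^sup>1 = \<rho>\<^sub>n\<^sub>-\<^sub>1 \<dots> \<rho>\<^sub>1\<close>, where all other factors are already known.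
\<close>

lemma r_in_subgroup:
  assumes "subgroup H G" "W \<in> H" "\<And>i. i \<le> n - 2 \<Longrightarrow> torsion_gen i \<in> H"
    and "1 \<le> j" "j \<le> n"
  shows "r j \<in> H"
proof -
  interpret H: subgroup H G by fact
  have rn: "r n \<in> H"
  proof -
    have "r n = W \<otimes> inv (torsion_gen 0)"
      by (simp add: torsion_gen_0 inv_mult_group)
    then show ?thesis using assms(2,3) by simp
  qed
  have low: "r i \<in> H" if "1 \<le> i" "i \<le> n - 2" for i
  proof -
    have "r i = torsion_gen i \<otimes> inv W"
      using that two_le_n by (simp add: torsion_gen_pos m_assoc)
    then show ?thesis using assms(2,3) that by simp
  qed
  have "r (n - 1) \<in> H"
  proof -
    let ?d = "descending G r (n - 2) (n - 2)"
    have d: "?d \<in> H" using low assms(1) by (intro descending_in_subgroup) auto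
    have "descending G r (n - 1) (n - 1) = r (n - 1) \<otimes> ?d"
      using descending_Suc_left[of r "n - 2" "n - 2"] two_le_n
      by (simp del: descending.simps add: Suc_diff_Suc numeral_2_eq_2)
    moreover have "descending G r (n - 1) (n - 1) = torsion_gen 0"
      using rot_pow_self[of "n - 1"] two_le_n by (simp add: torsion_gen_def)
    ultimately have "r (n - 1) = torsion_gen 0 \<otimes> inv ?d"
      by (subst eq_mult_inv_iff) auto
    then show ?thesis using assms(3)[of 0] d by simp
  qed
  moreover consider "j \<le> n - 2" | "j = n - 1" | "j = n"
    using assms(5) by linarith
  ultimately show ?thesis using rn low assms(4) by cases auto
qed

definition rho_group :: "'a set" where "rho_group = generate G (r ` {1..n})"

lemma subgroup_rho_group: "subgroup rho_group G"
  unfolding rho_group_def by (rule generate_is_subgroup) auto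

lemma rho_group_closed: "x \<in> rho_group \<Longrightarrow> x \<in> carrier G"
  using subgroup.subset[OF subgroup_rho_group] by auto

lemma r_in_rho_group: "1 \<le> j \<Longrightarrow> j \<le> n \<Longrightarrow> r j \<in> rho_group"
  unfolding rho_group_def by (intro generate.incl) auto

lemma W_in_rho_group: "W \<in> rho_group"
  using descending_in_subgroup[OF subgroup_rho_group, of n n] r_in_rho_group rot_pow_self[of n] two_le_n by simp

lemma torsion_gen_in_rho_group:
  assumes "i \<le> n"
  shows "torsion_gen i \<in> rho_group"
proof (cases "i = 0")
  case True
  then show ?thesis
    using subgroup_rho_group r_in_rho_group[of n] W_in_rho_group two_le_n
    by (simp add: torsion_gen_0 subgroup.m_closed subgroup.m_inv_closed)
next
  case False
  then show ?thesis
    using subgroup_rho_group r_in_rho_group[of i] W_in_rho_group assms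
    by (simp add: torsion_gen_pos subgroup.m_closed)
qed

lemma s_square_in_rho_group:
  assumes "1 \<le> i" "i < n"
  shows "s i \<otimes> s i \<in> rho_group"
proof -
  interpret rho_group: subgroup rho_group G by (rule subgroup_rho_group)
  have "r i \<in> rho_group" "r (i + 1) \<in> rho_group" using assms r_in_rho_group by auto
  moreover have "s i \<otimes> s i = inv (r i \<otimes> r (i + 1)) \<otimes> (r (i + 1) \<otimes> r i)"
    by (subst r_r_s_s[OF assms, symmetric]) (simp add: m_assoc inv_mult_group)
  ultimately show ?thesis by simp
qed

text \<open>
  Since \<open>\<sigma>\<^sub>i \<rho>\<^sub>i\<^sub>+\<^sub>1 \<sigma>\<^sub>i = \<rho>\<^sub>i\<close>, conjugation by \<open>\<sigma>\<^sub>i\<close> exchanges \<open>\<rho>\<^sub>i\<close> and \<open>\<rho>\<^sub>i\<^sub>+\<^sub>1\<close> up to the factors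
  \<open>\<sigma>\<^sub>i\<^sup>2\<close>, which are commutators of \<open>\<rho>\<close>'s.
\<close>

lemma conj_r_in_rho_group:
  assumes "1 \<le> i" "i < n" "1 \<le> j" "j \<le> n"
  shows "s i \<otimes> r j \<otimes> inv (s i) \<in> rho_group"
proof -
  interpret rho_group: subgroup rho_group G by (rule subgroup_rho_group)
  have sq: "s i \<otimes> s i \<in> rho_group" using assms by (intro s_square_in_rho_group)
  have rel: "s i \<otimes> r (i + 1) \<otimes> s i = r i" using assms by (intro s_r_s)
  consider "j = i" | "j = i + 1" | "j \<noteq> i" "j \<noteq> i + 1" by blast
  then show ?thesis
  proof cases
    case 1
    have "s i \<otimes> r i \<otimes> inv (s i) = (s i \<otimes> s i) \<otimes> r (i + 1)"
      by (subst rel[symmetric]) (simp add: m_assoc)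
    then show ?thesis using 1 sq r_in_rho_group[of "i + 1"] assms by simp
  next
    case 2
    have "s i \<otimes> r (i + 1) \<otimes> inv (s i) = (s i \<otimes> r (i + 1) \<otimes> s i) \<otimes> inv (s i \<otimes> s i)"
      by (simp add: m_assoc inv_mult_group)
    then show ?thesis using 2 sq r_in_rho_group[of i] assms unfolding rel by simp
  next
    case 3
    have "s i \<otimes> r j = r j \<otimes> s i" using 3 assms by (intro s_r_far) auto
    then show ?thesis using r_in_rho_group[of j] assms by (simp add: m_assoc)
  qed
qed

lemma conj_s_in_rho_group:
  assumes "1 \<le> i" "i < n" "x \<in> rho_group"
  shows "s i \<otimes> x \<otimes> inv (s i) \<in> rho_group"
  unfolding rho_group_def
proof (rule conj_generate)
  show "s i \<otimes> y \<otimes> inv (s i) \<in> generate G (r ` {1..n})" if "y \<in> r ` {1..n}" for y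
    using that conj_r_in_rho_group[OF assms(1,2)] unfolding rho_group_def by auto
  show "x \<in> generate G (r ` {1..n})" using assms(3) unfolding rho_group_def .
qed auto

lemma conj_desc_in_rho_group:
  assumes "m < n" "l \<le> m" "x \<in> rho_group"
  shows "desc m l \<otimes> x \<otimes> inv (desc m l) \<in> rho_group"
  using assms(2,3)
proof (induction l arbitrary: x)
  case 0
  then show ?case by (simp add: rho_group_closed)
next
  case (Suc l)
  have x: "x \<in> carrier G" using Suc.prems rho_group_closed by simp
  have "s (m - l) \<otimes> x \<otimes> inv (s (m - l)) \<in> rho_group"
    using Suc.prems assms(1) by (intro conj_s_in_rho_group) auto
  then have "desc m l \<otimes> (s (m - l) \<otimes> x \<otimes> inv (s (m - l))) \<otimes> inv (desc m l) \<in> rho_group"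
    using Suc by simp
  then show ?case using x by (simp add: m_assoc inv_mult_group)
qed

text \<open>
  The braids that only permute the first \<open>m\<close> strings. They interpolate between \<open>rho_group\<close>
  (for \<open>m = 1\<close>) and the group generated by all \<open>\<sigma>\<close>'s and \<open>\<rho>\<close>'s (for \<open>m = n\<close>).
\<close>

definition partial_braids :: "nat \<Rightarrow> 'a set" where
  "partial_braids m = generate G (r ` {1..n} \<union> s ` {1..<m})"

lemma subgroup_partial_braids: "subgroup (partial_braids m) G"
  unfolding partial_braids_def by (rule generate_is_subgroup) auto

lemma rho_group_subset_partial_braids: "rho_group \<subseteq> partial_braids m"
  unfolding rho_group_def partial_braids_def by (rule mono_generate) auto

lemma s_in_partial_braids: "1 \<le> i \<Longrightarrow> i < m \<Longrightarrow> s i \<in> partial_braids m"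
  unfolding partial_braids_def by (intro generate.incl) auto

text \<open>
  Coset representatives as in the symmetric group: \<open>\<sigma>\<^sub>m \<sigma>\<^sub>m\<^sub>-\<^sub>1 \<dots> \<sigma>\<^sub>m\<^sub>-\<^sub>l\<^sub>+\<^sub>1\<close> moves the point
  \<open>m - l + 1\<close> to \<open>m + 1\<close>. The union of these cosets is stable under right multiplication by each
  generator; the only case that leaves the braid relations is the repetition of a crossing,
  where \<open>\<sigma>\<^sub>j\<^sup>2\<close> lies in \<open>rho_group\<close>, which the representatives normalize.
\<close>

lemma partial_braids_Suc_cases:
  assumes "1 \<le> m" "m < n" "x \<in> partial_braids (m + 1)"
  obtains g l where "g \<in> partial_braids m" "l \<le> m" "x = g \<otimes> desc m l"
proof -
  interpret p: subgroup "partial_braids m" G by (rule subgroup_partial_braids)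
  define P where "P = (\<lambda>x. \<exists>g\<in>partial_braids m. \<exists>l\<le>m. x = g \<otimes> desc m l)"
  have rho_group: "P (y \<otimes> h)" if y: "P y" and "h \<in> rho_group" for y h
  proof -
    obtain g l where g: "g \<in> partial_braids m" "l \<le> m" "y = g \<otimes> desc m l"
      using y unfolding P_def by blast
    have h: "h \<in> carrier G" using that(2) rho_group_closed by simp
    have "desc m l \<otimes> h \<otimes> inv (desc m l) \<in> partial_braids m"
      using conj_desc_in_rho_group[OF assms(2) g(2) that(2)] rho_group_subset_partial_braids by auto
    then have "g \<otimes> (desc m l \<otimes> h \<otimes> inv (desc m l)) \<in> partial_braids m" using g(1) by simp
    moreover have "y \<otimes> h = g \<otimes> (desc m l \<otimes> h \<otimes> inv (desc m l)) \<otimes> desc m l"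
      using g h by (simp add: m_assoc)
    ultimately show ?thesis using g(2) by (auto simp: P_def)
  qed
  have S: "P (y \<otimes> s j)" if y: "P y" and j: "1 \<le> j" "j \<le> m" for y j
  proof -
    obtain g l where g: "g \<in> partial_braids m" "l \<le> m" "y = g \<otimes> desc m l"
      using y unfolding P_def by blast
    have gc: "g \<in> carrier G" using g by simp
    consider "j < m - l" | "j = m - l" | "j = m - l + 1" "1 \<le> l" | "m - l + 1 < j"
      using j g(2) by linarith
    then show ?thesis
    proof cases
      case 1
      have "s j \<otimes> desc m l = desc m l \<otimes> s j"
        using 1 that assms g(2) by (intro descending_commute s_far) auto
      then have "y \<otimes> s j = (g \<otimes> s j) \<otimes> desc m l" using g gc by (simp add: m_assoc)
      moreover have "g \<otimes> s j \<in> partial_braids m" using g(1) s_in_partial_braids[of j m] 1 that by simp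
      ultimately show ?thesis using g(2) by (auto simp: P_def)
    next
      case 2
      then have "y \<otimes> s j = g \<otimes> desc m (Suc l)" using g gc by (simp add: m_assoc)
      moreover have "Suc l \<le> m" using 2 that by simp
      ultimately show ?thesis using g(1) unfolding P_def by blast
    next
      case 3
      then obtain k where l: "l = Suc k" by (cases l) auto
      with 3 g(2) have "m - k = j" by linarith
      then have "y \<otimes> s j = (g \<otimes> desc m k) \<otimes> (s j \<otimes> s j)"
        using g l gc by (simp add: m_assoc)
      moreover have "P (g \<otimes> desc m k)" unfolding P_def using g l by (metis Suc_leD)
      ultimately show ?thesis using rho_group s_square_in_rho_group[of j] that assms by simp
    next
      case 4
      have "desc m l \<otimes> s (j - 1 + 1) = s (j - 1) \<otimes> desc m l"
        using 4 that assms g(2) by (intro desc_shift) auto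
      then have "desc m l \<otimes> s j = s (j - 1) \<otimes> desc m l" using that by simp
      then have "y \<otimes> s j = (g \<otimes> s (j - 1)) \<otimes> desc m l" using g gc by (simp add: m_assoc)
      moreover have "g \<otimes> s (j - 1) \<in> partial_braids m"
        using g(1) s_in_partial_braids[of "j - 1" m] 4 that by simp
      ultimately show ?thesis using g(2) by (auto simp: P_def)
    qed
  qed
  have gens: "r ` {1..n} \<union> s ` {1..<m + 1} \<subseteq> carrier G" by auto
  have "P x"
    using assms(3) gens unfolding partial_braids_def
  proof (induction rule: generate_right_induct)
    case one
    have "\<one> = \<one> \<otimes> desc m 0" by simp
    then show ?case unfolding P_def using p.one_closed by blast
  next
    case (mult y a)
    then show ?case using rho_group[of y] S[of y] r_in_rho_group by auto
  next
    case (mult_inv y a)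
    show ?case
    proof (cases "a \<in> r ` {1..n}")
      case True
      then have "inv a \<in> rho_group" using r_in_rho_group subgroup.m_inv_closed[OF subgroup_rho_group] by auto
      then show ?thesis using rho_group mult_inv by simp
    next
      case False
      then obtain j where j: "1 \<le> j" "j \<le> m" "a = s j" using mult_inv by auto
      have "inv (s j \<otimes> s j) \<in> rho_group"
        using s_square_in_rho_group[of j] j assms subgroup.m_inv_closed[OF subgroup_rho_group] by simp
      then have "P (y \<otimes> s j \<otimes> inv (s j \<otimes> s j))"
        using rho_group S[of y j] j mult_inv by simp
      then show ?thesis using j mult_inv.hyps by (simp add: m_assoc inv_mult_group)
    qed
  qed
  then show thesis using that unfolding P_def by blast
qed

text \<open>
  A braid that fixes all points has the trivial coset representative at every level
  \<open>m\<close>, because the others move a point to \<open>m + 1\<close> while \<open>partial_braids m\<close> fixes \<open>m + 1\<close>.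
  Descending from \<open>m = n\<close> to \<open>m = 1\<close> removes all \<open>\<sigma>\<close>'s.
\<close>

lemma kernel_perm_subset_rho_group:
  assumes hom: "\<phi> \<in> hom G (sym_group n)"
    and s: "\<And>i. 1 \<le> i \<Longrightarrow> i < n \<Longrightarrow> \<phi> (s i) = transpose i (i + 1)"
    and r: "\<And>j. 1 \<le> j \<Longrightarrow> j \<le> n \<Longrightarrow> \<phi> (r j) = id"
    and x: "x \<in> generate G (r ` {1..n} \<union> s ` {1..<n})" "\<phi> x = id"
  shows "x \<in> rho_group"
proof -
  interpret \<phi>: group_hom G "sym_group n" \<phi>
    using hom sym_group_is_group by (intro group_hom.intro group_hom_axioms.intro) (auto intro: group_axioms)
  have mult: "\<phi> (g \<otimes> h) = \<phi> g \<circ> \<phi> h" if "g \<in> carrier G" "h \<in> carrier G" for g h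
    using \<phi>.hom_mult[OF that] by (simp add: sym_group_def)
  have one: "\<phi> \<one> = id" using \<phi>.hom_one by (simp add: sym_group_def)
  have fix_inv: "\<phi> (inv g) k = k" if "g \<in> carrier G" "\<phi> g k = k" for g k
  proof -
    have "\<phi> (inv g) \<circ> \<phi> g = id" using mult[of "inv g" g] that one by simp
    then show ?thesis using that(2) by (metis comp_apply id_apply)
  qed
  have fixed: "\<phi> g k = k" if "g \<in> partial_braids m" "m < k" "m \<le> n" for g k m
    using that(1) unfolding partial_braids_def
  proof (induction rule: generate.induct)
    case one
    then show ?case using \<open>\<phi> \<one> = id\<close> by simp
  next
    case (incl h)
    then show ?case using that r s by (auto simp: transpose_def)
  next
    case (inv h)
    then have "\<phi> h k = k" "h \<in> carrier G" using that r s by (auto simp: transpose_def)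
    then show ?case by (rule fix_inv[rotated])
  next
    case (eng h1 h2)
    then have "h1 \<in> carrier G" "h2 \<in> carrier G"
      by (auto elim!: generate_in_carrier[rotated])
    then show ?case using eng mult by simp
  qed
  have moves: "\<phi> (desc m l) (m + 1 - l) = m + 1" if "m < n" "l \<le> m" for m l
    using that(2)
  proof (induction l)
    case 0
    then show ?case using one by simp
  next
    case (Suc l)
    have "\<phi> (desc m (Suc l)) (m - l) = \<phi> (desc m l) (\<phi> (s (m - l)) (m - l))"
      using mult[of "desc m l" "s (m - l)"] by simp
    also have "\<phi> (s (m - l)) (m - l) = m + 1 - l"
      using s[of "m - l"] Suc.prems that(1) by (simp add: Suc_diff_le)
    finally show ?case using Suc by simp
  qed
  have "x \<in> partial_braids m" if "1 \<le> m" "m \<le> n" for m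
    using that(2,1)
  proof (induction m rule: inc_induct)
    case base
    then show ?case using x(1) by (simp add: partial_braids_def)
  next
    case (step m)
    then have "x \<in> partial_braids (m + 1)" by simp
    then obtain g l where g: "g \<in> partial_braids m" "l \<le> m" "x = g \<otimes> desc m l"
      using partial_braids_Suc_cases[of m x] step by auto
    have gc: "g \<in> carrier G" using g(1) subgroup.subset[OF subgroup_partial_braids] by auto
    have "\<phi> x (m + 1 - l) = \<phi> g (\<phi> (desc m l) (m + 1 - l))"
      using g(3) gc mult[of g "desc m l"] by simp
    also have "\<dots> = m + 1"
      using moves[of m l] fixed[of g m "m + 1"] g step by simp
    finally have "m + 1 - l = m + 1" using x(2) by simp
    then have "l = 0" using g(2) by linarith
    then show ?case using g gc by simp
  qed
  from this[of 1] show ?thesis using two_le_n by (simp add: partial_braids_def rho_group_def)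
qed

end

section \<open>Homomorphisms out of a presented group\<close>

primrec eval_word :: "('a, 'm) monoid_scheme \<Rightarrow> ('g \<Rightarrow> 'a) \<Rightarrow> 'g word \<Rightarrow> 'a" where
  "eval_word H f [] = \<one>\<^bsub>H\<^esub>"
| "eval_word H f (a # w) =
    (if snd a then f (fst a) else inv\<^bsub>H\<^esub> f (fst a)) \<otimes>\<^bsub>H\<^esub> eval_word H f w"

context group
begin

lemma eval_word_closed: "(\<And>x. f x \<in> carrier G) \<Longrightarrow> eval_word G f w \<in> carrier G"
  by (induction w) auto

lemma eval_word_append:
  "(\<And>x. f x \<in> carrier G) \<Longrightarrow> eval_word G f (u @ v) = eval_word G f u \<otimes> eval_word G f v"
  by (induction u) (auto simp: m_assoc eval_word_closed)

lemma eval_word_inv: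
  "(\<And>x. f x \<in> carrier G) \<Longrightarrow> eval_word G f (inv_word w) = inv (eval_word G f w)"
  by (induction w) (auto simp: inv_word_def eval_word_append eval_word_closed inv_mult_group)

text \<open>
  The universal property. The homomorphism is obtained by evaluating any word in a class, the value
  being constant on classes.
\<close>

lemma presented_group_hom:
  assumes f: "\<And>x. f x \<in> carrier G"
    and R: "\<And>l r. (l, r) \<in> R \<Longrightarrow> eval_word G f l = eval_word G f r"
  obtains h where "h \<in> hom (presented_group S R) G"
    "\<And>w. w \<in> words S \<Longrightarrow> h (word_class S R w) = eval_word G f w"
proof -
  have cong: "eval_word G f u = eval_word G f v" if "(u, v) \<in> word_cong S R" for u v
    using that
  proof (induction rule: word_cong.induct)
    case (cancel u v x e)
    then show ?case using f by (cases e) (simp_all add: eval_word_append eval_word_closed)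
  next
    case (relation u v l r)
    then show ?case using f R by (simp add: eval_word_append)
  qed auto
  define h where "h = (\<lambda>c. the_elem (eval_word G f ` c))"
  have h: "h (word_class S R w) = eval_word G f w" if w: "w \<in> words S" for w
  proof -
    have "w \<in> word_class S R w"
      using w by (auto simp: word_class_def intro: word_cong.refl)
    moreover have "eval_word G f v = eval_word G f w" if "v \<in> word_class S R w" for v
      using that cong[of w v] by (simp add: word_class_def)
    ultimately have "eval_word G f ` word_class S R w = {eval_word G f w}" by blast
    then show ?thesis by (simp add: h_def)
  qed
  have "h \<in> hom (presented_group S R) G"
  proof (rule homI)
    fix x assume "x \<in> carrier (presented_group S R)"
    then obtain u where u: "u \<in> words S" "x = word_class S R u"
      by (auto simp: carrier_presented_group)
    then show "h x \<in> carrier G" using f by (simp add: h eval_word_closed)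
    fix y assume "y \<in> carrier (presented_group S R)"
    then obtain v where v: "v \<in> words S" "y = word_class S R v"
      by (auto simp: carrier_presented_group)
    show "h (x \<otimes>\<^bsub>presented_group S R\<^esub> y) = h x \<otimes> h y"
      using u v f by (simp add: mult_presented_group h eval_word_append)
  qed
  with h show thesis using that by blast
qed

end

lemma presented_group_generated:
  assumes "subgroup H (presented_group S R)" "\<And>x. x \<in> S \<Longrightarrow> word_class S R [(x, True)] \<in> H"
  shows "H = carrier (presented_group S R)"
proof
  interpret group "presented_group S R" by (rule group_presented_group)
  interpret H: subgroup H "presented_group S R" by fact
  have mult: "word_class S R (a # w) = word_class S R [a] \<otimes>\<^bsub>presented_group S R\<^esub> word_class S R w"
    if "a # w \<in> words S" for a w
    using that by (cases a) (simp add: mult_presented_group)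
  have one: "word_class S R [] = \<one>\<^bsub>presented_group S R\<^esub>" by (simp add: presented_group_def)
  have neg: "word_class S R [(x, False)] = inv\<^bsub>presented_group S R\<^esub> word_class S R [(x, True)]"
    if "x \<in> S" for x
  proof (rule inv_equality[symmetric])
    have "word_class S R ([(x, False)] @ [(x, True)]) = word_class S R []"
      using word_cong.cancel[of "[]" S "[]" x False R] that by (simp add: word_class_eq_iff)
    then show "word_class S R [(x, False)] \<otimes>\<^bsub>presented_group S R\<^esub> word_class S R [(x, True)]
        = \<one>\<^bsub>presented_group S R\<^esub>"
      using that by (simp add: mult_presented_group one del: append.simps)
  qed (use that in \<open>auto simp: carrier_presented_group\<close>)
  have "word_class S R w \<in> H" if "w \<in> words S" for w
    using that
  proof (induction w)
    case Nil
    then show ?case by (simp add: one)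
  next
    case (Cons a w)
    obtain x e where a: "a = (x, e)" by (cases a)
    have "word_class S R [a] \<in> H"
      using Cons.prems a assms(2) neg by (cases e) auto
    moreover have "word_class S R w \<in> H" using Cons a by simp
    ultimately show ?case using mult[OF Cons.prems] by simp
  qed
  then show "carrier (presented_group S R) \<subseteq> H" by (auto simp: carrier_presented_group)
  show "H \<subseteq> carrier (presented_group S R)" by (rule H.subset)
qed

section \<open>The universal property of the braid groups\<close>

text \<open>
  The generators as total families; outside their range they are set to the identity,
  so that they always lie in the group.
\<close>

definition sgen :: "nat \<Rightarrow> nat \<Rightarrow> braid_gen word set" where
  "sgen n i = (if i \<in> {1..<n} then braid n (sig i) else \<one>\<^bsub>braid_group n\<^esub>)"

definition rgen :: "nat \<Rightarrow> nat \<Rightarrow> braid_gen word set" where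
  "rgen n j = (if j \<in> {1..n} then braid n (rho j) else \<one>\<^bsub>braid_group n\<^esub>)"

abbreviation braid_words :: "nat \<Rightarrow> braid_gen word set" where
  "braid_words n \<equiv> words (braid_gens n)"

lemma Sig_in_gens [simp]: "Sig i \<in> braid_gens n \<longleftrightarrow> 1 \<le> i \<and> i < n"
  and Rho_in_gens [simp]: "Rho j \<in> braid_gens n \<longleftrightarrow> 1 \<le> j \<and> j \<le> n"
  by (auto simp: braid_gens_def)

lemma braid_append:
  "u \<in> braid_words n \<Longrightarrow> v \<in> braid_words n \<Longrightarrow>
    braid n (u @ v) = braid n u \<otimes>\<^bsub>braid_group n\<^esub> braid n v"
  by (simp add: braid_def braid_group_def mult_presented_group)

lemma braid_closed: "u \<in> braid_words n \<Longrightarrow> braid n u \<in> carrier (braid_group n)"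
  by (auto simp: braid_def braid_group_def carrier_presented_group)

lemma braid_Nil: "braid n [] = \<one>\<^bsub>braid_group n\<^esub>"
  by (simp add: braid_def braid_group_def presented_group_def)

lemma braid_inv_word:
  assumes "u \<in> braid_words n"
  shows "braid n (inv_word u) = inv\<^bsub>braid_group n\<^esub> braid n u"
proof -
  interpret group "braid_group n" by (rule group_braid_group)
  have "braid n (inv_word u @ u) = braid n []"
    using word_cong_inv[OF assms] assms by (simp add: braid_def word_class_eq_iff)
  then show ?thesis
    using assms by (intro inv_equality[symmetric]) (simp_all add: braid_append braid_Nil braid_closed)
qed

lemma braid_relation:
  assumes "(l, r) \<in> braid_rels n" "l \<in> braid_words n" "r \<in> braid_words n"
  shows "braid n l = braid n r"
  using word_cong.relation[of "[]" "braid_gens n" "[]" l r "braid_rels n"] assms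
  by (simp add: braid_def word_class_eq_iff)

lemma sgen_closed [simp]: "sgen n i \<in> carrier (braid_group n)"
  using monoid.one_closed[OF group.is_monoid[OF group_braid_group]]
  by (auto simp: sgen_def intro: braid_closed)

lemma rgen_closed [simp]: "rgen n i \<in> carrier (braid_group n)"
  using monoid.one_closed[OF group.is_monoid[OF group_braid_group]]
  by (auto simp: rgen_def intro: braid_closed)

lemma sig_words:
  assumes "m < n"
  shows "concat (map sig [1..<Suc m]) \<in> braid_words n"
    "concat (map sig (rev [1..<Suc m])) \<in> braid_words n"
  using assms by (induction m) auto

lemma braid_ascending:
  assumes "m < n"
  shows "braid n (concat (map sig [1..<Suc m])) = ascending (braid_group n) (sgen n) m"
  using assms
proof (induction m)
  case (Suc m)
  then show ?case
    using sig_words(1)[of m n] braid_append[of "concat (map sig [1..<Suc m])" n "sig (Suc m)"]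
    by (simp add: sgen_def)
qed (simp add: braid_Nil)

lemma braid_descending:
  assumes "m < n"
  shows "braid n (concat (map sig (rev [1..<Suc m]))) = descending (braid_group n) (sgen n) m m"
  using assms
proof (induction m)
  case (Suc m)
  interpret group "braid_group n" by (rule group_braid_group)
  have "descending (braid_group n) (sgen n) (Suc m) (Suc m) =
      sgen n (Suc m) \<otimes>\<^bsub>braid_group n\<^esub> descending (braid_group n) (sgen n) m m"
    by (rule descending_Suc_left) simp
  moreover have "sgen n (Suc m) = braid n (sig (Suc m))"
    using Suc.prems by (simp add: sgen_def)
  ultimately show ?case
    using Suc sig_words(2)[of m n] braid_append[of "sig (Suc m)" n "concat (map sig (rev [1..<Suc m]))"]
    by (simp del: descending.simps)
qed (simp add: braid_Nil)

lemma projective_braids_braid_group: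
  assumes n: "2 \<le> n"
  shows "projective_braids (braid_group n) n (sgen n) (rgen n)"
proof -
  interpret group "braid_group n" by (rule group_braid_group)
  let ?B = "braid_group n"
  have s: "sgen n i = braid n (sig i)" if "1 \<le> i" "i < n" for i using that by (simp add: sgen_def)
  have r: "rgen n i = braid n (rho i)" if "1 \<le> i" "i \<le> n" for i using that by (simp add: rgen_def)
  show ?thesis
  proof
    fix i j assume ij: "1 \<le> i" "i + 2 \<le> j" "j < n"
    have "braid n (sig i @ sig j) = braid n (sig j @ sig i)"
      using ij by (intro braid_relation) (auto simp: braid_rels_def)
    then show "sgen n i \<otimes>\<^bsub>?B\<^esub> sgen n j = sgen n j \<otimes>\<^bsub>?B\<^esub> sgen n i"
      using ij by (simp add: s braid_append del: append.simps)
  next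
    fix i assume i: "1 \<le> i" "i + 2 \<le> n"
    have "braid n (sig i @ sig (i + 1) @ sig i) = braid n (sig (i + 1) @ sig i @ sig (i + 1))"
      using i by (intro braid_relation) (auto simp: braid_rels_def)
    then show "sgen n i \<otimes>\<^bsub>?B\<^esub> sgen n (i + 1) \<otimes>\<^bsub>?B\<^esub> sgen n i =
        sgen n (i + 1) \<otimes>\<^bsub>?B\<^esub> sgen n i \<otimes>\<^bsub>?B\<^esub> sgen n (i + 1)"
      using i by (simp add: s braid_append braid_closed m_assoc del: append.simps)
  next
    fix i j assume ij: "1 \<le> i" "i < n" "1 \<le> j" "j \<le> n" "j \<noteq> i" "j \<noteq> i + 1"
    have "braid n (sig i @ rho j) = braid n (rho j @ sig i)"
      using ij by (intro braid_relation) (auto simp: braid_rels_def)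
    then show "sgen n i \<otimes>\<^bsub>?B\<^esub> rgen n j = rgen n j \<otimes>\<^bsub>?B\<^esub> sgen n i"
      using ij by (simp add: s r braid_append del: append.simps)
  next
    fix i assume i: "1 \<le> i" "i < n"
    have sw: "sig i \<in> braid_words n" "rho i \<in> braid_words n" "rho (i + 1) \<in> braid_words n"
      using i by auto
    have "braid n (rho (i + 1)) = braid n (inv_word (sig i) @ rho i @ inv_word (sig i))"
      using i sw by (intro braid_relation) (auto simp: braid_rels_def)
    then have "rgen n (i + 1) = inv\<^bsub>?B\<^esub> sgen n i \<otimes>\<^bsub>?B\<^esub> (rgen n i \<otimes>\<^bsub>?B\<^esub> inv\<^bsub>?B\<^esub> sgen n i)"
      using i sw by (simp add: s r braid_append braid_inv_word del: append.simps)
    then show "sgen n i \<otimes>\<^bsub>?B\<^esub> rgen n (i + 1) \<otimes>\<^bsub>?B\<^esub> sgen n i = rgen n i"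
      by (simp add: m_assoc)
    have "braid n (inv_word (rho (i + 1)) @ inv_word (rho i) @ rho (i + 1) @ rho i) =
        braid n (sig i @ sig i)"
      using i sw by (intro braid_relation) (auto simp: braid_rels_def)
    then have eq: "inv\<^bsub>?B\<^esub> rgen n (i + 1) \<otimes>\<^bsub>?B\<^esub> (inv\<^bsub>?B\<^esub> rgen n i \<otimes>\<^bsub>?B\<^esub>
        (rgen n (i + 1) \<otimes>\<^bsub>?B\<^esub> rgen n i)) = sgen n i \<otimes>\<^bsub>?B\<^esub> sgen n i"
      using i sw by (simp add: s r braid_append braid_inv_word del: append.simps)
    show "rgen n i \<otimes>\<^bsub>?B\<^esub> rgen n (i + 1) \<otimes>\<^bsub>?B\<^esub> (sgen n i \<otimes>\<^bsub>?B\<^esub> sgen n i) =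
        rgen n (i + 1) \<otimes>\<^bsub>?B\<^esub> rgen n i"
      unfolding eq[symmetric] by (simp add: m_assoc)
  next
    obtain m where m: "n = Suc m" "m < n" using n by (cases n) auto
    note sw = sig_words[OF m(2)]
    have "braid n (rho 1 @ rho 1) =
        braid n (concat (map sig [1..<n]) @ concat (map sig (rev [1..<n])))"
    proof (rule braid_relation)
      show "(rho 1 @ rho 1, concat (map sig [1..<n]) @ concat (map sig (rev [1..<n]))) \<in> braid_rels n"
        unfolding braid_rels_def by blast
    qed (use sw m n in \<open>auto simp del: upt_Suc\<close>)
    also have "\<dots> = braid n (concat (map sig [1..<n])) \<otimes>\<^bsub>?B\<^esub> braid n (concat (map sig (rev [1..<n])))"
      using sw m(1) by (intro braid_append) (simp_all only:)
    also have "\<dots> = ascending ?B (sgen n) (n - 1) \<otimes>\<^bsub>?B\<^esub> descending ?B (sgen n) (n - 1) (n - 1)"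
      using braid_ascending[OF m(2)] braid_descending[OF m(2)] m(1) by (simp only: diff_Suc_1)
    also have "braid n (rho 1 @ rho 1) = rgen n 1 \<otimes>\<^bsub>?B\<^esub> rgen n 1"
      using n by (simp add: r braid_append del: append.simps)
    finally show "rgen n 1 \<otimes>\<^bsub>?B\<^esub> rgen n 1 =
        ascending ?B (sgen n) (n - 1) \<otimes>\<^bsub>?B\<^esub> descending ?B (sgen n) (n - 1) (n - 1)" .
  qed (use n in auto)
qed

lemma braid_group_generated:
  assumes "subgroup H (braid_group n)"
    and "\<And>i. 1 \<le> i \<Longrightarrow> i < n \<Longrightarrow> sgen n i \<in> H" "\<And>j. 1 \<le> j \<Longrightarrow> j \<le> n \<Longrightarrow> rgen n j \<in> H"
  shows "H = carrier (braid_group n)"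
  unfolding braid_group_def
proof (rule presented_group_generated)
  show "subgroup H (presented_group (braid_gens n) (braid_rels n))"
    using assms(1) by (simp add: braid_group_def)
  show "word_class (braid_gens n) (braid_rels n) [(x, True)] \<in> H" if "x \<in> braid_gens n" for x
    using that assms(2,3)
    by (cases x) (auto simp: sgen_def rgen_def braid_def split: if_splits)
qed

text \<open>
  Each family of elements satisfying the relations, in whichever group, is the image of the
  generators. All homomorphisms below are instances of this.
\<close>

lemma braid_group_hom:
  assumes "projective_braids H n s r"
  obtains h where "h \<in> hom (braid_group n) H"
    "\<And>i. 1 \<le> i \<Longrightarrow> i < n \<Longrightarrow> h (sgen n i) = s i"
    "\<And>j. 1 \<le> j \<Longrightarrow> j \<le> n \<Longrightarrow> h (rgen n j) = r j"
proof -
  interpret H: projective_braids H n s r by fact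
  define f where "f = case_braid_gen s r"
  have f: "f x \<in> carrier H" for x by (cases x) (auto simp: f_def)
  note ev = H.eval_word_append[of f, OF f] H.eval_word_inv[of f, OF f]
  have [simp]: "eval_word H f (sig i) = s i" "eval_word H f (rho i) = r i" for i
    by (simp_all add: f_def)
  have pal: "eval_word H f (concat (map sig [1..<Suc m])) = ascending H s m"
    "eval_word H f (concat (map sig (rev [1..<Suc m]))) = descending H s m m" for m
  proof (induction m)
    case (Suc m)
    {
      case 1
      show ?case using Suc(1) by (simp add: ev del: eval_word.simps)
    next
      case 2
      have "eval_word H f (concat (map sig (rev [1..<Suc (Suc m)]))) =
          eval_word H f (sig (Suc m) @ concat (map sig (rev [1..<Suc m])))" by simp
      then show ?case using Suc(2) H.desc_Suc_left[of m m]
        by (simp only: ev) (simp add: ev del: eval_word.simps descending.simps upt_Suc)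
    }
  qed simp_all
  have rel: "eval_word H f u = eval_word H f v" if "(u, v) \<in> braid_rels n" for u v
    using that unfolding braid_rels_def
  proof (elim UnE CollectE exE conjE insertE emptyE Pair_inject)
    fix i j assume uv: "u = sig i @ sig j" "v = sig j @ sig i" and ij: "i \<in> {1..<n}" "j \<in> {1..<n}"
      "2 \<le> \<bar>int i - int j\<bar>"
    have "s i \<otimes>\<^bsub>H\<^esub> s j = s j \<otimes>\<^bsub>H\<^esub> s i"
    proof (cases "i < j")
      case True
      then show ?thesis using ij by (intro H.s_far) auto
    next
      case False
      then show ?thesis using ij by (intro H.s_far[symmetric]) auto
    qed
    then show ?thesis unfolding uv by (simp add: ev del: eval_word.simps append.simps)
  next
    fix i assume "u = sig i @ sig (i + 1) @ sig i" "v = sig (i + 1) @ sig i @ sig (i + 1)"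
      "1 \<le> i" "i + 2 \<le> n"
    then show ?thesis
      using H.s_braid[of i] by (simp add: ev H.m_assoc del: eval_word.simps append.simps)
  next
    fix i j assume "u = sig i @ rho j" "v = rho j @ sig i" "i \<in> {1..<n}" "j \<in> {1..n}"
      "j \<noteq> i" "j \<noteq> i + 1"
    then show ?thesis
      using H.s_r_far[of i j] by (simp add: ev del: eval_word.simps append.simps)
  next
    fix i assume uv: "u = rho (i + 1)" "v = inv_word (sig i) @ rho i @ inv_word (sig i)"
      and i: "i \<in> {1..<n}"
    have rel: "s i \<otimes>\<^bsub>H\<^esub> r (i + 1) \<otimes>\<^bsub>H\<^esub> s i = r i" using i by (intro H.s_r_s) auto
    have "eval_word H f v = inv\<^bsub>H\<^esub> s i \<otimes>\<^bsub>H\<^esub> (r i \<otimes>\<^bsub>H\<^esub> inv\<^bsub>H\<^esub> s i)"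
      unfolding uv by (simp add: ev del: eval_word.simps append.simps)
    also have "\<dots> = r (i + 1)" unfolding rel[symmetric] by (simp add: H.m_assoc)
    finally show ?thesis using uv by (simp del: eval_word.simps)
  next
    fix i assume uv: "u = inv_word (rho (i + 1)) @ inv_word (rho i) @ rho (i + 1) @ rho i"
      "v = sig i @ sig i" and i: "i \<in> {1..<n}"
    have rel: "r i \<otimes>\<^bsub>H\<^esub> r (i + 1) \<otimes>\<^bsub>H\<^esub> (s i \<otimes>\<^bsub>H\<^esub> s i) = r (i + 1) \<otimes>\<^bsub>H\<^esub> r i"
      using i by (intro H.r_r_s_s) auto
    have "eval_word H f u = inv\<^bsub>H\<^esub> r (i + 1) \<otimes>\<^bsub>H\<^esub> (inv\<^bsub>H\<^esub> r i \<otimes>\<^bsub>H\<^esub> (r (i + 1) \<otimes>\<^bsub>H\<^esub> r i))"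
      unfolding uv by (simp add: ev del: eval_word.simps append.simps)
    also have "\<dots> = s i \<otimes>\<^bsub>H\<^esub> s i" unfolding rel[symmetric] by (simp add: H.m_assoc)
    finally show ?thesis using uv by (simp add: ev del: eval_word.simps append.simps)
  next
    assume uv: "u = rho 1 @ rho 1"
      "v = concat (map sig [1..<n]) @ concat (map sig (rev [1..<n]))"
    obtain m where m: "n = Suc m" using H.two_le_n by (cases n) auto
    show ?thesis unfolding uv
      using H.r_1_square pal[of m] m by (simp add: ev del: eval_word.simps append.simps upt_Suc)
  qed
  obtain h where h: "h \<in> hom (braid_group n) H"
    "\<And>w. w \<in> braid_words n \<Longrightarrow> h (braid n w) = eval_word H f w"
    using H.presented_group_hom[of f "braid_rels n" "braid_gens n"] f rel
    unfolding braid_group_def braid_def by blast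
  show thesis
    by (rule that[OF h(1)]) (auto simp: sgen_def rgen_def h(2) simp del: eval_word.simps)
qed

section \<open>Models of the relations\<close>

lemma descending_cong:
  assumes "\<And>i. 1 \<le> i \<Longrightarrow> i \<le> m \<Longrightarrow> f i = g i" "l \<le> m"
  shows "descending G f m l = descending G g m l"
  using assms(2)
proof (induction l)
  case (Suc l)
  then show ?case using assms(1)[of "m - l"] by simp
qed simp

lemma (in group_hom) hom_descending:
  assumes "\<And>i. f i \<in> carrier G"
  shows "h (descending G f m l) = descending H (\<lambda>i. h (f i)) m l"
  using assms by (induction l) (auto simp: G.descending_closed)

lemma descending_Z2: "descending (integer_mod_group 2) (\<lambda>_. u) m l = int l * u mod 2"
  by (induction l) (simp_all add: mod_simps algebra_simps)

lemma ascending_Z2: "ascending (integer_mod_group 2) (\<lambda>_. u) l = int l * u mod 2"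
  by (induction l) (simp_all add: mod_simps algebra_simps)

text \<open>
  Both sides of every relation contain the same number of \<open>\<sigma>\<close>'s modulo 2, and
  likewise of \<open>\<rho>\<close>'s, so the values in \<open>\<int>\<^sub>2\<close> may be prescribed independently.
\<close>

lemma projective_braids_Z2:
  assumes "2 \<le> n" "u \<in> {0, 1}" "v \<in> {0, 1}"
  shows "projective_braids (integer_mod_group 2) n (\<lambda>_. u) (\<lambda>_. v)"
proof -
  interpret group "integer_mod_group 2" by simp
  show ?thesis
  proof
    show "u \<in> carrier (integer_mod_group 2)" "v \<in> carrier (integer_mod_group 2)"
      using assms by (auto simp: carrier_integer_mod_group)
    show "v \<otimes>\<^bsub>integer_mod_group 2\<^esub> v = ascending (integer_mod_group 2) (\<lambda>_. u) (n - 1)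
        \<otimes>\<^bsub>integer_mod_group 2\<^esub> descending (integer_mod_group 2) (\<lambda>_. u) (n - 1) (n - 1)"
      by (simp add: descending_Z2 ascending_Z2 mod_simps flip: mult_2)
  qed (use assms in auto)
qed

subsection \<open>Groups of bijections\<close>

lemma BijGroup_UNIV [simp]:
  "carrier (BijGroup UNIV) = {f. bij f}"
  "\<one>\<^bsub>BijGroup UNIV\<^esub> = id"
  by (auto simp: BijGroup_def Bij_def id_def)

lemma mult_BijGroup_UNIV [simp]:
  "bij f \<Longrightarrow> bij g \<Longrightarrow> f \<otimes>\<^bsub>BijGroup UNIV\<^esub> g = f \<circ> g"
  by (auto simp: BijGroup_def Bij_def compose_def)

lemma bij_descending: "(\<And>i. bij (f i)) \<Longrightarrow> bij (descending (BijGroup UNIV) f m l)"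
  using monoid.descending_closed[OF group.is_monoid[OF group_BijGroup[of UNIV]], where f = f] by simp

lemma bij_ascending: "(\<And>i. bij (f i)) \<Longrightarrow> bij (ascending (BijGroup UNIV) f l)"
  using monoid.ascending_closed[OF group.is_monoid[OF group_BijGroup[of UNIV]], where f = f] by simp

lemma descending_BijGroup_Suc:
  "(\<And>i. bij (f i)) \<Longrightarrow> descending (BijGroup UNIV) f (Suc m) (Suc l) =
    f (Suc m) \<circ> descending (BijGroup UNIV) f m l"
  using monoid.descending_Suc_left[OF group.is_monoid[OF group_BijGroup[of UNIV]], where f = f]
  by (simp add: bij_descending del: descending.simps)

lemma ascending_BijGroup_Suc:
  "(\<And>i. bij (f i)) \<Longrightarrow> ascending (BijGroup UNIV) f (Suc m) = ascending (BijGroup UNIV) f m \<circ> f (Suc m)"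
  by (simp add: bij_ascending)

lemma projective_braids_BijGroup:
  assumes "2 \<le> n" "\<And>i. bij (s i)" "\<And>j. bij (r j)"
    and "\<And>i j x. 1 \<le> i \<Longrightarrow> i + 2 \<le> j \<Longrightarrow> s i (s j x) = s j (s i x)"
    and "\<And>i x. 1 \<le> i \<Longrightarrow> s i (s (i + 1) (s i x)) = s (i + 1) (s i (s (i + 1) x))"
    and "\<And>i j x. 1 \<le> i \<Longrightarrow> i < n \<Longrightarrow> 1 \<le> j \<Longrightarrow> j \<noteq> i \<Longrightarrow> j \<noteq> i + 1 \<Longrightarrow> s i (r j x) = r j (s i x)"
    and "\<And>i x. 1 \<le> i \<Longrightarrow> i < n \<Longrightarrow> s i (r (i + 1) (s i x)) = r i x"
    and "\<And>i x. 1 \<le> i \<Longrightarrow> i < n \<Longrightarrow> r i (r (i + 1) (s i (s i x))) = r (i + 1) (r i x)"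
    and "\<And>x. r 1 (r 1 x) =
      ascending (BijGroup UNIV) s (n - 1) (descending (BijGroup UNIV) s (n - 1) (n - 1) x)"
  shows "projective_braids (BijGroup UNIV) n s r"
proof -
  interpret group "BijGroup UNIV" by (rule group_BijGroup)
  show ?thesis
    by unfold_locales (use assms in \<open>auto simp: fun_eq_iff bij_comp bij_descending bij_ascending\<close>)
qed

subsection \<open>Lifts to the sphere\<close>

text \<open>
  A pair \<open>(p, e)\<close> is a string together with a lift of its position to the sphere: \<open>\<sigma>\<^sub>i\<close> permutes the
  strings, and \<open>\<rho>\<^sub>j\<close> passes to the antipodal lift of the \<open>j\<close>-th.
\<close>

definition swap_points :: "nat \<Rightarrow> nat \<times> bool \<Rightarrow> nat \<times> bool" where
  "swap_points i = (\<lambda>(p, e). (transpose i (i + 1) p, e))"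

definition flip_point :: "nat \<Rightarrow> nat \<times> bool \<Rightarrow> nat \<times> bool" where
  "flip_point j = (\<lambda>(p, e). (p, e \<noteq> (p = j)))"

lemma bij_swap_points: "bij (swap_points i)"
  by (rule involuntory_imp_bij) (auto simp: swap_points_def)

lemma bij_flip_point: "bij (flip_point j)"
  by (rule involuntory_imp_bij) (auto simp: flip_point_def)

lemma projective_braids_flips:
  assumes "2 \<le> n"
  shows "projective_braids (BijGroup UNIV) n swap_points flip_point"
proof (rule projective_braids_BijGroup)
  have sq: "swap_points i (swap_points i x) = x" for i x
    by (cases x) (simp add: swap_points_def)
  have "ascending (BijGroup UNIV) swap_points m (descending (BijGroup UNIV) swap_points m m x) = x" for m x
    by (induction m)
      (simp_all add: ascending_BijGroup_Suc descending_BijGroup_Suc bij_swap_points sq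
        del: descending.simps(2) ascending.simps(2))
  then show "flip_point 1 (flip_point 1 x) = ascending (BijGroup UNIV) swap_points (n - 1)
      (descending (BijGroup UNIV) swap_points (n - 1) (n - 1) x)" for x
    by (auto simp: flip_point_def split: prod.splits)
  show "bij (swap_points i)" "bij (flip_point i)" for i
    by (rule bij_swap_points, rule bij_flip_point)
qed (use assms in \<open>auto simp: swap_points_def flip_point_def transpose_def
    split: if_splits\<close>)

subsection \<open>Pairs of strings and quaternions\<close>

text \<open>
  Quaternions \<open>w + x i + y j + z k\<close> as quadruples \<open>(w, x, y, z)\<close>; the three maps are the left
  multiplications by \<open>i\<close>, \<open>j\<close> and \<open>k\<close>.
\<close>

type_synonym quat = "int \<times> int \<times> int \<times> int"

definition qi :: "quat \<Rightarrow> quat" where "qi = (\<lambda>(w, x, y, z). (- x, w, - z, y))"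
definition qj :: "quat \<Rightarrow> quat" where "qj = (\<lambda>(w, x, y, z). (- y, z, w, - x))"
definition qk :: "quat \<Rightarrow> quat" where "qk = (\<lambda>(w, x, y, z). (- z, - y, x, w))"

lemma quat_products [simp]:
  "qi (qi v) = - v" "qj (qj v) = - v" "qk (qk v) = - v"
  "qi (qj v) = qk v" "qj (qi v) = - qk v"
  "qj (qk v) = qi v" "qk (qj v) = - qi v"
  "qk (qi v) = qj v" "qi (qk v) = - qj v"
  "qi (- v) = - qi v" "qj (- v) = - qj v" "qk (- v) = - qk v"
  by (auto simp: qi_def qj_def qk_def split: prod.splits)

type_synonym quat_state = "nat \<times> nat \<times> quat"

text \<open>
  For two strings the pure braid group is the quaternion group, and forgetting all strings but an
  ordered pair \<open>(p, q)\<close> maps every pure braid to it. The following maps describe the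
  representation induced to all braids: the strings of the pair are permuted, and a crossing of
  the two strings with each other multiplies by \<open>k\<close>.
\<close>

definition quat_sigma :: "nat \<Rightarrow> quat_state \<Rightarrow> quat_state" where
  "quat_sigma i = (\<lambda>(p, q, v). (transpose i (i + 1) p, transpose i (i + 1) q,
     if p = i \<and> q = i + 1 \<or> p = i + 1 \<and> q = i then qk v else v))"

text \<open>
  The first string of the pair contributes \<open>i\<close> and the second one \<open>j\<close>. The action is trivial
  outside the ordered pairs of distinct strings, since the right-hand side of the relation for
  \<open>\<rho>\<^sub>1\<^sup>2\<close> acts trivially there.
\<close>

definition quat_rho :: "nat \<Rightarrow> nat \<Rightarrow> quat_state \<Rightarrow> quat_state" where
  "quat_rho n j = (\<lambda>(p, q, v). (p, q,
     if p \<noteq> q \<and> p \<in> {1..n} \<and> q \<in> {1..n}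
     then if p = j then qi v else if q = j then qj v else v else v))"

lemma adjacent_transpose_simps:
  "transpose i (Suc i) p = i \<longleftrightarrow> p = Suc i"
  "transpose i (Suc i) p = Suc i \<longleftrightarrow> p = i"
  "k \<noteq> i \<Longrightarrow> k \<noteq> Suc i \<Longrightarrow> transpose i (Suc i) p = k \<longleftrightarrow> p = k"
  "1 \<le> i \<Longrightarrow> i < n \<Longrightarrow> Suc 0 \<le> transpose i (Suc i) p \<longleftrightarrow> Suc 0 \<le> p"
  "i < n \<Longrightarrow> transpose i (Suc i) p \<le> n \<longleftrightarrow> p \<le> n"
  by (auto simp: transpose_def)

lemma quat_sigma_square:
  "quat_sigma i (quat_sigma i (p, q, v)) =
    (p, q, if p = i \<and> q = i + 1 \<or> p = i + 1 \<and> q = i then - v else v)"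
  by (simp add: quat_sigma_def adjacent_transpose_simps disj_commute conj_commute)

lemma quat_sigma_braid:
  "quat_sigma i (quat_sigma (i + 1) (quat_sigma i (p, q, v))) =
    quat_sigma (i + 1) (quat_sigma i (quat_sigma (i + 1) (p, q, v)))"
proof -
  consider (p0) "p = i" | (p1) "p = i + 1" | (p2) "p = i + 2" | (p3) "p \<noteq> i" "p \<noteq> i + 1" "p \<noteq> i + 2"
    by blast
  note p = this
  consider (q0) "q = i" | (q1) "q = i + 1" | (q2) "q = i + 2" | (q3) "q \<noteq> i" "q \<noteq> i + 1" "q \<noteq> i + 2"
    by blast
  then show ?thesis
    by (cases; cases rule: p) (simp_all add: quat_sigma_def transpose_def)
qed

lemma quat_sigma_far:
  assumes "i + 2 \<le> j"
  shows "quat_sigma i (quat_sigma j (p, q, v)) = quat_sigma j (quat_sigma i (p, q, v))"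
proof -
  have ne: "j \<noteq> i" "j \<noteq> Suc i" "i \<noteq> j" "i \<noteq> Suc j" "Suc i \<noteq> j" using assms by auto
  have pos: "transpose i (Suc i) (transpose j (Suc j) x) = transpose j (Suc j) (transpose i (Suc i) x)" for x
    using ne by (auto simp: transpose_def)
  show ?thesis
    using ne by (simp add: quat_sigma_def adjacent_transpose_simps pos)
qed

lemma bij_of_period_4: "(\<And>x. f (f (f (f x))) = x) \<Longrightarrow> bij f"
  by (rule o_bij[of "f \<circ> f \<circ> f"]) auto

lemma bij_quat_sigma: "bij (quat_sigma i)"
proof (rule bij_of_period_4)
  show "quat_sigma i (quat_sigma i (quat_sigma i (quat_sigma i x))) = x" for x
    by (cases x rule: prod_cases3) (simp add: quat_sigma_square)
qed

lemma quat_rho_in: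
  "p \<noteq> q \<Longrightarrow> p \<in> {1..n} \<Longrightarrow> q \<in> {1..n} \<Longrightarrow>
    quat_rho n j (p, q, v) = (p, q, if p = j then qi v else if q = j then qj v else v)"
  by (simp add: quat_rho_def)

lemma quat_rho_out:
  "\<not> (p \<noteq> q \<and> p \<in> {1..n} \<and> q \<in> {1..n}) \<Longrightarrow> quat_rho n j (p, q, v) = (p, q, v)"
  by (simp only: quat_rho_def prod.case if_False)

lemma quat_rho_square:
  "quat_rho n j (quat_rho n j (p, q, v)) =
    (p, q, if (p \<noteq> q \<and> p \<in> {1..n} \<and> q \<in> {1..n}) \<and> (p = j \<or> q = j) then - v else v)"
proof (cases "p \<noteq> q \<and> p \<in> {1..n} \<and> q \<in> {1..n}")
  case True
  then show ?thesis by (simp add: quat_rho_in)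
next
  case False
  then have "\<not> ((p \<noteq> q \<and> p \<in> {1..n} \<and> q \<in> {1..n}) \<and> (p = j \<or> q = j))" by blast
  then show ?thesis by (simp only: quat_rho_out[OF False] if_False)
qed

lemma quat_rho_rho_sigma_sigma:
  assumes "1 \<le> i" "i < n"
  shows "quat_rho n i (quat_rho n (i + 1) (quat_sigma i (quat_sigma i (p, q, v)))) =
      quat_rho n (i + 1) (quat_rho n i (p, q, v))"
proof (cases "p \<noteq> q \<and> p \<in> {1..n} \<and> q \<in> {1..n}")
  case True
  consider "p = i" | "p = i + 1" | "p \<noteq> i" "p \<noteq> i + 1" by blast
  then show ?thesis
    using True by cases (simp_all add: quat_sigma_square quat_rho_in)
next
  case False
  then have "\<not> (p = i \<and> q = i + 1 \<or> p = i + 1 \<and> q = i)" using assms by auto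
  then show ?thesis
    unfolding quat_sigma_square by (simp only: if_False quat_rho_out[OF False])
qed

lemma bij_quat_rho: "bij (quat_rho n j)"
proof (rule bij_of_period_4)
  show "quat_rho n j (quat_rho n j (quat_rho n j (quat_rho n j x))) = x" for x
    by (cases x rule: prod_cases3) (auto simp: quat_rho_square)
qed

definition quat_neg :: "quat_state \<Rightarrow> quat_state" where "quat_neg = (\<lambda>(p, q, v). (p, q, - v))"

abbreviation quat_desc :: "nat \<Rightarrow> quat_state \<Rightarrow> quat_state" where
  "quat_desc m \<equiv> descending (BijGroup UNIV) quat_sigma m m"
abbreviation quat_asc :: "nat \<Rightarrow> quat_state \<Rightarrow> quat_state" where
  "quat_asc \<equiv> ascending (BijGroup UNIV) quat_sigma"

lemma quat_desc_Suc: "quat_desc (Suc m) x = quat_sigma (Suc m) (quat_desc m x)"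
  by (simp add: descending_BijGroup_Suc bij_quat_sigma del: descending.simps)

lemma quat_asc_Suc: "quat_asc (Suc m) x = quat_asc m (quat_sigma (Suc m) x)"
  by (simp add: ascending_BijGroup_Suc bij_quat_sigma del: ascending.simps)

lemma quat_asc_neg: "quat_asc m (quat_neg x) = quat_neg (quat_asc m x)"
proof (induction m arbitrary: x)
  case (Suc m)
  have "quat_sigma (Suc m) (quat_neg x) = quat_neg (quat_sigma (Suc m) x)"
    by (cases x rule: prod_cases3) (simp add: quat_sigma_def quat_neg_def)
  then show ?case using Suc by (simp only: quat_asc_Suc)
qed simp

lemma quat_desc_eq:
  "quat_desc m (p, q, v) =
    (if p = 1 then m + 1 else if p = 0 \<or> m + 1 < p then p else p - 1,
     if q = 1 then m + 1 else if q = 0 \<or> m + 1 < q then q else q - 1,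
     if p = 1 \<and> 1 < q \<and> q \<le> m + 1 \<or> q = 1 \<and> 1 < p \<and> p \<le> m + 1 then qk v else v)"
proof (induction m)
  case 0
  then show ?case by auto
next
  case (Suc m)
  have pos: "transpose (Suc m) (Suc m + 1) (if p = 1 then m + 1 else if p = 0 \<or> m + 1 < p then p else p - 1)
      = (if p = 1 then Suc m + 1 else if p = 0 \<or> Suc m + 1 < p then p else p - 1)" for p
    by (auto simp: transpose_def)
  show ?case
    unfolding quat_desc_Suc Suc unfolding quat_sigma_def prod.case pos by auto
qed

text \<open>
  In \<open>\<sigma>\<^sub>1 \<dots> \<sigma>\<^sub>m \<sigma>\<^sub>m \<dots> \<sigma>\<^sub>1\<close> the first string crosses each of the strings
  \<open>2, \<dots>, m + 1\<close> twice, which gives \<open>k\<^sup>2 = -1\<close>, and no other two strings cross.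
\<close>

lemma quat_asc_desc:
  "quat_asc m (quat_desc m (p, q, v)) =
    (p, q, if p = 1 \<and> 1 < q \<and> q \<le> m + 1 \<or> q = 1 \<and> 1 < p \<and> p \<le> m + 1 then - v else v)"
proof (induction m)
  case (Suc m)
  let ?new = "p = 1 \<and> q = m + 2 \<or> q = 1 \<and> p = m + 2"
  have "quat_sigma (Suc m) (quat_sigma (Suc m) (quat_desc m (p, q, v))) =
      (if ?new then quat_neg (quat_desc m (p, q, v)) else quat_desc m (p, q, v))"
    unfolding quat_desc_eq quat_sigma_square quat_neg_def prod.case by auto
  then have "quat_asc (Suc m) (quat_desc (Suc m) (p, q, v)) =
      (if ?new then quat_neg (quat_asc m (quat_desc m (p, q, v)))
       else quat_asc m (quat_desc m (p, q, v)))"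
    by (cases ?new) (simp_all only: quat_asc_Suc quat_desc_Suc quat_asc_neg if_True if_False)
  then show ?case unfolding Suc by (auto simp: quat_neg_def)
qed auto

lemma projective_braids_quat:
  assumes "2 \<le> n"
  shows "projective_braids (BijGroup UNIV) n quat_sigma (quat_rho n)"
proof (rule projective_braids_BijGroup)
  fix x :: quat_state
  obtain p q v where x: "x = (p, q, v)" by (cases x rule: prod_cases3) auto
  have "quat_rho n 1 (quat_rho n 1 (p, q, v)) =
      (p, q, if p = 1 \<and> 1 < q \<and> q \<le> n \<or> q = 1 \<and> 1 < p \<and> p \<le> n then - v else v)"
    using assms unfolding quat_rho_square by auto
  then show "quat_rho n 1 (quat_rho n 1 x) = quat_asc (n - 1) (quat_desc (n - 1) x)"
    unfolding x quat_asc_desc using assms by simp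
next
  show "quat_sigma i (quat_rho n j x) = quat_rho n j (quat_sigma i x)"
    if "1 \<le> i" "i < n" "1 \<le> j" "j \<noteq> i" "j \<noteq> i + 1" for i j x
    using that by (cases x rule: prod_cases3) (auto simp: quat_sigma_def quat_rho_def adjacent_transpose_simps)
next
  show "quat_sigma i (quat_rho n (i + 1) (quat_sigma i x)) = quat_rho n i x"
    if "1 \<le> i" "i < n" for i x
    using that by (cases x rule: prod_cases3) (auto simp: quat_sigma_def quat_rho_def adjacent_transpose_simps)
next
  show "quat_rho n i (quat_rho n (i + 1) (quat_sigma i (quat_sigma i x))) =
      quat_rho n (i + 1) (quat_rho n i x)"
    if "1 \<le> i" "i < n" for i x
    using quat_rho_rho_sigma_sigma[OF that] by (cases x rule: prod_cases3) auto
next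
  show "quat_sigma i (quat_sigma j x) = quat_sigma j (quat_sigma i x)"
    if "i + 2 \<le> j" for i j x
    using quat_sigma_far[OF that] by (cases x rule: prod_cases3) auto
next
  show "quat_sigma i (quat_sigma (i + 1) (quat_sigma i x)) =
      quat_sigma (i + 1) (quat_sigma i (quat_sigma (i + 1) x))" for i x
    using quat_sigma_braid by (cases x rule: prod_cases3) auto
qed (use assms in \<open>auto simp: bij_quat_sigma bij_quat_rho\<close>)

text \<open>
  On the pair \<open>(1, 2)\<close> the product \<open>\<rho>\<^sub>n \<dots> \<rho>\<^sub>1\<close> acts as \<open>j i = -k\<close>, whose square is \<open>-1\<close>.
\<close>

lemma quat_full_twist:
  assumes "2 \<le> n"
  defines "W \<equiv> descending (BijGroup UNIV) (quat_rho n) n n"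
  shows "W \<otimes>\<^bsub>BijGroup UNIV\<^esub> W \<noteq> \<one>\<^bsub>BijGroup UNIV\<^esub>"
proof
  have W: "W (1, 2, v) = (1, 2, - qk v)" for v
  proof -
    have "descending (BijGroup UNIV) (quat_rho n) m m (1, 2, v) =
        (1, 2, if 2 \<le> m then - qk v else if m = 1 then qi v else v)" for m
    proof (induction m)
      case (Suc m)
      have "descending (BijGroup UNIV) (quat_rho n) (Suc m) (Suc m) (1, 2, v) =
          quat_rho n (Suc m) (descending (BijGroup UNIV) (quat_rho n) m m (1, 2, v))"
        by (simp add: descending_BijGroup_Suc bij_quat_rho del: descending.simps)
      then show ?case unfolding Suc using assms(1) by (auto simp: quat_rho_in)
    qed simp
    then show ?thesis using assms by simp
  qed
  have "bij W" unfolding W_def by (intro bij_descending bij_quat_rho)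
  moreover assume "W \<otimes>\<^bsub>BijGroup UNIV\<^esub> W = \<one>\<^bsub>BijGroup UNIV\<^esub>"
  ultimately have "W (W (1, 2, (1, 0, 0, 0))) = (1, 2, (1, 0, 0, 0))"
    by (simp add: fun_eq_iff)
  then show False by (simp only: W) simp
qed

section \<open>Normal closures, ranks and characters\<close>

context group
begin

lemma normal_carrier: "carrier G \<lhd> G"
  by (intro normal_invI subgroup_self) auto

lemma normal_closure_least: "N \<lhd> G \<Longrightarrow> A \<subseteq> N \<Longrightarrow> normal_closure G A \<subseteq> N"
  by (auto simp: normal_closure_def)

lemma normal_closure_incl: "A \<subseteq> normal_closure G A"
  by (auto simp: normal_closure_def)

lemma normal_normal_closure:
  assumes "A \<subseteq> carrier G"
  shows "normal_closure G A \<lhd> G"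
proof (rule normal_invI)
  have ne: "{N. N \<lhd> G \<and> A \<subseteq> N} \<noteq> {}" using assms normal_carrier by auto
  show "subgroup (normal_closure G A) G"
    unfolding normal_closure_def using ne
    by (intro subgroups_Inter) (auto intro: normal_imp_subgroup)
  show "x \<otimes> h \<otimes> inv x \<in> normal_closure G A"
    if "x \<in> carrier G" "h \<in> normal_closure G A" for x h
    using that by (auto simp: normal_closure_def normal.inv_op_closed2)
qed

lemma generated_imp_normally_generated:
  assumes "generated_by G A"
  shows "normally_generated_by G A"
proof -
  have A: "A \<subseteq> carrier G" "generate G A = carrier G"
    using assms by (auto simp: generated_by_def)
  have N: "normal_closure G A \<lhd> G" by (rule normal_normal_closure) fact
  have "generate G A \<subseteq> normal_closure G A"
    using N by (intro generate_subgroup_incl normal_closure_incl normal_imp_subgroup)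
  moreover have "normal_closure G A \<subseteq> carrier G"
    using N by (intro subgroup.subset normal_imp_subgroup)
  ultimately show ?thesis using A by (auto simp: normally_generated_by_def)
qed

text \<open>
  Homomorphisms to an abelian group are constant on conjugacy classes, so two of them that agree on
  a set agree on its normal closure.
\<close>

lemma normal_equalizer:
  assumes H: "comm_group H" and f: "f \<in> hom G H" and g: "g \<in> hom G H"
  shows "{x \<in> carrier G. f x = g x} \<lhd> G"
proof -
  interpret H: comm_group H by fact
  interpret f: group_hom G H f using f by unfold_locales
  interpret g: group_hom G H g using g by unfold_locales
  show ?thesis
  proof (rule normal_invI)
    show "subgroup {x \<in> carrier G. f x = g x} G"
      by (rule subgroupI) auto
    fix x h assume x: "x \<in> carrier G" and h: "h \<in> {x \<in> carrier G. f x = g x}"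
    have "k (x \<otimes> h \<otimes> inv x) = k h" if "group_hom G H k" for k
    proof -
      interpret k: group_hom G H k by fact
      have "k (x \<otimes> h \<otimes> inv x) = k h \<otimes>\<^bsub>H\<^esub> (k x \<otimes>\<^bsub>H\<^esub> inv\<^bsub>H\<^esub> k x)"
        using x h by (simp add: H.m_ac del: H.r_inv)
      then show ?thesis using x h by simp
    qed
    from this[OF f.group_hom_axioms] this[OF g.group_hom_axioms]
    have "f (x \<otimes> h \<otimes> inv x) = f h" "g (x \<otimes> h \<otimes> inv x) = g h" .
    moreover have "f h = g h" using h by blast
    ultimately have "f (x \<otimes> h \<otimes> inv x) = g (x \<otimes> h \<otimes> inv x)" by (simp only:)
    then show "x \<otimes> h \<otimes> inv x \<in> {x \<in> carrier G. f x = g x}"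
      using x h by (intro CollectI conjI m_closed inv_closed) auto
  qed
qed

text \<open>
  The sums of the given homomorphisms over the \<open>2\<^sup>|\<^sup>J\<^sup>|\<close> subsets of \<open>J\<close> are pairwise distinct by
  duality. Restricted to \<open>A\<close> there are only \<open>2\<^sup>|\<^sup>A\<^sup>|\<close> functions with values in \<open>\<int>\<^sub>2\<close>. So for
  \<open>|A| < |J|\<close> two distinct sums would agree on \<open>A\<close>, hence on the normal closure of \<open>A\<close>.
\<close>

lemma card_normal_generators_ge:
  assumes "finite J"
    and c: "\<And>j. j \<in> J \<Longrightarrow> c j \<in> hom G (integer_mod_group 2)"
    and g: "\<And>j. j \<in> J \<Longrightarrow> g j \<in> carrier G"
    and dual: "\<And>i j. i \<in> J \<Longrightarrow> j \<in> J \<Longrightarrow> c i (g j) = (if i = j then 1 else 0)"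
    and A: "normally_generated_by G A" "finite A"
  shows "card J \<le> card A"
proof (rule ccontr)
  assume less: "\<not> card J \<le> card A"
  define \<chi> where "\<chi> = (\<lambda>T x. (\<Sum>j\<in>T. c j x) mod (2 :: int))"
  have \<chi>: "\<chi> T \<in> hom G (integer_mod_group 2)" if "T \<subseteq> J" for T
  proof (rule homI)
    show "\<chi> T x \<in> carrier (integer_mod_group 2)" for x
      by (simp add: \<chi>_def carrier_integer_mod_group)
    fix x y assume xy: "x \<in> carrier G" "y \<in> carrier G"
    have "\<chi> T (x \<otimes> y) = (\<Sum>j\<in>T. (c j x + c j y) mod 2) mod 2"
      unfolding \<chi>_def using that xy c
      by (intro arg_cong2[of _ _ _ _ "(mod)"] sum.cong) (auto simp: hom_def)
    also have "\<dots> = (\<Sum>j\<in>T. c j x + c j y) mod 2" by (rule mod_sum_eq)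
    finally show "\<chi> T (x \<otimes> y) = \<chi> T x \<otimes>\<^bsub>integer_mod_group 2\<^esub> \<chi> T y"
      by (simp add: \<chi>_def sum.distrib mod_simps)
  qed
  have AG: "A \<subseteq> carrier G" "normal_closure G A = carrier G"
    using A(1) by (auto simp: normally_generated_by_def)
  let ?F = "\<lambda>T. restrict (\<chi> T) A"
  have "?F ` Pow J \<subseteq> A \<rightarrow>\<^sub>E {0, 1}"
    by (auto simp: \<chi>_def)
  then have "card (?F ` Pow J) \<le> card (A \<rightarrow>\<^sub>E {0, 1 :: int})"
    using A(2) by (intro card_mono finite_PiE) auto
  also have "\<dots> = 2 ^ card A" using A(2) by (simp add: card_PiE numeral_2_eq_2)
  also have "\<dots> < card (Pow J)"
    using less \<open>finite J\<close> by (simp add: card_Pow)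
  finally have "\<not> inj_on ?F (Pow J)" by (rule pigeonhole)
  then obtain T U where TU: "T \<subseteq> J" "U \<subseteq> J" "T \<noteq> U" "?F T = ?F U"
    by (auto simp: inj_on_def)
  let ?N = "{x \<in> carrier G. \<chi> T x = \<chi> U x}"
  have "\<chi> T x = \<chi> U x" if "x \<in> A" for x
    using fun_cong[OF TU(4), of x] that by simp
  then have "A \<subseteq> ?N" using AG by auto
  moreover have "?N \<lhd> G" using \<chi> TU by (intro normal_equalizer) auto
  ultimately have "carrier G \<subseteq> ?N" using normal_closure_least AG by metis
  then have eq: "\<chi> T x = \<chi> U x" if "x \<in> carrier G" for x using that by auto
  have val: "\<chi> V (g j) = (if j \<in> V then 1 else 0)" if "V \<subseteq> J" "j \<in> J" for V j
  proof -
    have "finite V" using that \<open>finite J\<close> finite_subset by auto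
    have "(\<Sum>i\<in>V. c i (g j)) = (\<Sum>i\<in>V. if i = j then 1 else 0)"
      using that by (intro sum.cong dual) auto
    also have "\<dots> = (if j \<in> V then 1 else 0)" using \<open>finite V\<close> by (simp add: sum.delta)
    finally show ?thesis by (simp add: \<chi>_def)
  qed
  have "T = U"
  proof (rule Set.set_eqI)
    fix j
    show "j \<in> T \<longleftrightarrow> j \<in> U"
    proof (cases "j \<in> J")
      case True
      then show ?thesis using val[OF TU(1) True] val[OF TU(2) True] eq[OF g[OF True]]
        by (auto split: if_splits)
    qed (use TU in auto)
  qed
  with TU(3) show False by simp
qed

text \<open>
  Modulo the normal closure \<open>N\<close> of \<open>x\<close> the group is generated by the class of \<open>y\<close>, whose square
  is trivial. Hence each element lies in \<open>N\<close> or in the coset of \<open>y\<close>, and \<open>\<chi>\<close> tells the two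
  apart, so that its kernel is exactly \<open>N\<close>.
\<close>

lemma FactGroup_iso_Z2:
  assumes gen: "generated_by G {x, y}"
    and \<chi>: "\<chi> \<in> hom G (integer_mod_group 2)" "\<chi> x = 0" "\<chi> y = 1"
    and sq: "y \<otimes> y \<in> normal_closure G {x}"
  shows "G Mod normal_closure G {x} \<cong> integer_mod_group 2"
proof -
  let ?N = "normal_closure G {x}"
  have xy: "x \<in> carrier G" "y \<in> carrier G" "generate G {x, y} = carrier G"
    using gen by (auto simp: generated_by_def)
  interpret N: normal ?N G using xy by (intro normal_normal_closure) auto
  interpret \<chi>: group_hom G "integer_mod_group 2" \<chi>
    by (intro group_hom.intro group_hom_axioms.intro \<chi>(1) group_axioms group_integer_mod_group)
  have x: "x \<in> ?N" using normal_closure_incl[of "{x}"] by simp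
  have cases: "g \<in> ?N \<or> g \<otimes> y \<in> ?N" if "g \<in> carrier G" for g
  proof -
    have "g \<in> generate G {x, y}" "{x, y} \<subseteq> carrier G" using that xy by auto
    then show ?thesis
    proof (induction rule: generate_right_induct)
      case one
      show ?case by simp
    next
      case (mult g a)
      have 1: "g \<otimes> x \<otimes> y = g \<otimes> y \<otimes> (inv y \<otimes> x \<otimes> y)" "g \<otimes> y \<otimes> y = g \<otimes> (y \<otimes> y)"
        using mult(1) xy by (simp_all add: m_assoc)
      have "inv y \<otimes> x \<otimes> y \<in> ?N" using x xy by (intro N.inv_op_closed1) auto
      then show ?case using mult 1 x sq by (metis N.m_closed insertE singletonD)
    next
      case (mult_inv g a)
      have 1: "g \<otimes> inv x \<otimes> y = g \<otimes> y \<otimes> (inv y \<otimes> inv x \<otimes> y)"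
        "g \<otimes> inv y = g \<otimes> y \<otimes> inv (y \<otimes> y)" "g \<otimes> inv y \<otimes> y = g"
        using mult_inv(1) xy by (simp_all add: m_assoc inv_mult_group)
      have "inv y \<otimes> inv x \<otimes> y \<in> ?N" using x xy by (intro N.inv_op_closed1) auto
      then show ?case using mult_inv 1 x sq by (metis N.m_closed N.m_inv_closed insertE singletonD)
    qed
  qed
  have "kernel G (integer_mod_group 2) \<chi> = ?N"
  proof
    show N: "?N \<subseteq> kernel G (integer_mod_group 2) \<chi>"
      using xy \<chi> by (intro normal_closure_least \<chi>.normal_kernel) (auto simp: kernel_def)
    show "kernel G (integer_mod_group 2) \<chi> \<subseteq> ?N"
    proof
      fix g assume g: "g \<in> kernel G (integer_mod_group 2) \<chi>"
      then have "\<chi> (g \<otimes> y) = 1" using xy \<chi> by (simp add: kernel_def)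
      then have "g \<otimes> y \<notin> ?N" using N by (auto simp: kernel_def)
      then show "g \<in> ?N" using cases[of g] g by (auto simp: kernel_def)
    qed
  qed
  moreover have "\<chi> ` carrier G = carrier (integer_mod_group 2)"
  proof
    show "\<chi> ` carrier G \<subseteq> carrier (integer_mod_group 2)" by auto
    have "carrier (integer_mod_group 2) = {\<chi> x, \<chi> y}"
      using \<chi> by (auto simp: carrier_integer_mod_group)
    then show "carrier (integer_mod_group 2) \<subseteq> \<chi> ` carrier G" using xy by auto
  qed
  ultimately show ?thesis using \<chi>.FactGroup_iso by simp
qed

lemma ord_eq_4I:
  assumes "x \<in> carrier G" "(x \<otimes> x) \<otimes> (x \<otimes> x) = \<one>" "x \<otimes> x \<noteq> \<one>"
  shows "ord x = 4"
proof -
  have pow: "x [^] (2 :: nat) = x \<otimes> x" "x [^] (4 :: nat) = (x \<otimes> x) \<otimes> (x \<otimes> x)"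
    using assms(1) by (simp_all add: numeral_eq_Suc m_assoc)
  have d: "ord x dvd 4" "\<not> ord x dvd 2"
    using pow_eq_id[OF assms(1), of 4] pow_eq_id[OF assms(1), of 2] pow assms by auto
  have "ord x \<le> 4" using d(1) by (auto dest: dvd_imp_le)
  then have "ord x \<in> {0, 1, 2, 3, 4}" by auto
  then show ?thesis using d by auto
qed

end

lemma min_card_eq:
  assumes "finite A" "P A" "card A \<le> k"
    and "\<And>A. finite A \<Longrightarrow> P A \<Longrightarrow> k \<le> card A"
  shows "min_card P = enat k"
proof (rule antisym)
  show "min_card P \<le> enat k"
    unfolding min_card_def using assms(1-3) by (intro INF_lower2[of A]) auto
  show "enat k \<le> min_card P"
    unfolding min_card_def using assms(4) by (intro INF_greatest) auto
qed

section \<open>The braid groups and the pure braid groups\<close>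

context projective_braids
begin

lemma rot_pred_square_in_normal_closure:
  "rot (n - 1) \<otimes> rot (n - 1) \<in> normal_closure G {rot n}"
proof -
  let ?a = "rot n" and ?b = "rot (n - 1)"
  let ?N = "normal_closure G {?a}"
  interpret N: normal ?N G by (intro normal_normal_closure) auto
  have a: "?a \<in> ?N" using normal_closure_incl[of "{?a}"] by simp
  have pow: "?a [^] k \<in> ?N" for k :: nat using a by (induction k) auto
  have "?b \<otimes> inv (?a [^] (n - 1)) \<otimes> inv ?b \<in> ?N"
    using pow by (intro N.inv_op_closed2) auto
  then have "?b \<otimes> inv (?a [^] (n - 1)) \<otimes> inv ?b \<otimes> (?a [^] (n + 1)) \<in> ?N"
    using pow[of "n + 1"] by (rule N.m_closed)
  moreover have "?b \<otimes> inv (?a [^] (n - 1)) \<otimes> inv ?b \<otimes> (?a [^] (n + 1)) = ?b \<otimes> ?b"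
    unfolding rot_pred_rot_pow_rot_pred[symmetric] by (simp add: m_assoc)
  ultimately show ?thesis by (simp only:)
qed

lemma rot_square_in_normal_closure:
  "rot n \<otimes> rot n \<in> normal_closure G {rot (n - 1)}"
proof -
  let ?a = "rot n" and ?b = "rot (n - 1)"
  let ?N = "normal_closure G {?b}"
  interpret N: normal ?N G by (intro normal_normal_closure) auto
  have b: "?b \<in> ?N" using normal_closure_incl[of "{?b}"] by simp
  have "inv (?a [^] (n - 1)) \<otimes> ?b \<otimes> ?a [^] (n - 1) \<in> ?N"
    using b by (intro N.inv_op_closed1) auto
  then have "(inv (?a [^] (n - 1)) \<otimes> ?b \<otimes> ?a [^] (n - 1)) \<otimes> ?b \<in> ?N"
    using b by (rule N.m_closed)
  moreover have "(inv (?a [^] (n - 1)) \<otimes> ?b \<otimes> ?a [^] (n - 1)) \<otimes> ?b = ?a \<otimes> ?a"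
  proof -
    have "(n - 1) + 2 = n + 1" using two_le_n by simp
    then have "?a [^] (n + 1) = ?a [^] (n - 1) \<otimes> ?a [^] (2 :: nat)"
      by (metis nat_pow_mult rot_closed)
    then have "?b \<otimes> ?a [^] (n - 1) \<otimes> ?b = ?a [^] (n - 1) \<otimes> (?a \<otimes> ?a)"
      unfolding rot_pred_rot_pow_rot_pred by (simp add: numeral_2_eq_2)
    then have "inv (?a [^] (n - 1)) \<otimes> (?b \<otimes> ?a [^] (n - 1) \<otimes> ?b) = ?a \<otimes> ?a" by simp
    then show ?thesis by (simp add: m_assoc)
  qed
  ultimately show ?thesis by (simp only:)
qed

end

lemma braid_group_characters:
  assumes "2 \<le> n" "u \<in> {0, 1}" "v \<in> {0, 1}"
  obtains \<chi> where "\<chi> \<in> hom (braid_group n) (integer_mod_group 2)"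
    "\<And>i. 1 \<le> i \<Longrightarrow> i < n \<Longrightarrow> \<chi> (sgen n i) = u" "\<And>j. 1 \<le> j \<Longrightarrow> j \<le> n \<Longrightarrow> \<chi> (rgen n j) = v"
    "\<And>m. 1 \<le> m \<Longrightarrow> m \<le> n \<Longrightarrow>
      \<chi> (projective_braids.rot (braid_group n) (sgen n) (rgen n) m) = (v + int (m - 1) * u) mod 2"
proof -
  interpret B: projective_braids "braid_group n" n "sgen n" "rgen n"
    by (rule projective_braids_braid_group) fact
  obtain \<chi> where \<chi>: "\<chi> \<in> hom (braid_group n) (integer_mod_group 2)"
    "\<And>i. 1 \<le> i \<Longrightarrow> i < n \<Longrightarrow> \<chi> (sgen n i) = u" "\<And>j. 1 \<le> j \<Longrightarrow> j \<le> n \<Longrightarrow> \<chi> (rgen n j) = v"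
    by (rule braid_group_hom[OF projective_braids_Z2[OF assms]]) (rule that)
  interpret \<chi>: group_hom "braid_group n" "integer_mod_group 2" \<chi>
    by (intro group_hom.intro group_hom_axioms.intro \<chi>(1) group_braid_group group_integer_mod_group)
  have "\<chi> (B.rot m) = (v + int (m - 1) * u) mod 2" if "1 \<le> m" "m \<le> n" for m
  proof -
    have "descending (integer_mod_group 2) (\<lambda>i. \<chi> (sgen n i)) (m - 1) (m - 1)
        = descending (integer_mod_group 2) (\<lambda>_. u) (m - 1) (m - 1)"
      using \<chi>(2) that by (intro descending_cong) auto
    then show ?thesis
      using \<chi>(3)[of m] that
      by (simp add: B.rot_def \<chi>.hom_descending descending_Z2 mod_simps)
  qed
  with \<chi> show thesis using that by blast
qed

lemma braid_full_twist_nontrivial: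
  assumes "2 \<le> n"
  shows "descending (braid_group n) (rgen n) n n \<otimes>\<^bsub>braid_group n\<^esub>
    descending (braid_group n) (rgen n) n n \<noteq> \<one>\<^bsub>braid_group n\<^esub>"
proof
  interpret B: projective_braids "braid_group n" n "sgen n" "rgen n"
    by (rule projective_braids_braid_group) fact
  let ?W = "descending (braid_group n) (rgen n) n n"
  assume one: "?W \<otimes>\<^bsub>braid_group n\<^esub> ?W = \<one>\<^bsub>braid_group n\<^esub>"
  obtain h where h: "h \<in> hom (braid_group n) (BijGroup UNIV)"
    "\<And>i. 1 \<le> i \<Longrightarrow> i < n \<Longrightarrow> h (sgen n i) = quat_sigma i"
    "\<And>j. 1 \<le> j \<Longrightarrow> j \<le> n \<Longrightarrow> h (rgen n j) = quat_rho n j"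
    by (rule braid_group_hom[OF projective_braids_quat[OF assms]]) (rule that)
  interpret h: group_hom "braid_group n" "BijGroup UNIV" h
    by (intro group_hom.intro group_hom_axioms.intro h(1) group_braid_group group_BijGroup)
  have hW: "h ?W = descending (BijGroup UNIV) (quat_rho n) n n"
  proof -
    have "descending (BijGroup UNIV) (\<lambda>i. h (rgen n i)) n n = descending (BijGroup UNIV) (quat_rho n) n n"
      using h(3) by (intro descending_cong) auto
    then show ?thesis using h.hom_descending[of "rgen n" n n] by (metis rgen_closed)
  qed
  have "h ?W \<otimes>\<^bsub>BijGroup UNIV\<^esub> h ?W = \<one>\<^bsub>BijGroup UNIV\<^esub>"
    using one h.hom_mult[of ?W ?W] h.hom_one by (metis B.r_desc_closed)
  then show False using quat_full_twist[OF assms] unfolding hW by simp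
qed

lemma pure_braid_group_eq:
  assumes "2 \<le> n"
  shows "kernel (braid_group n) (sym_group n) braid_perm =
    projective_braids.rho_group (braid_group n) n (rgen n)"
proof
  interpret B: projective_braids "braid_group n" n "sgen n" "rgen n"
    by (rule projective_braids_braid_group) fact
  interpret p: group_hom "braid_group n" "sym_group n" braid_perm
    by (intro group_hom.intro group_hom_axioms.intro braid_perm_hom group_braid_group sym_group_is_group)
  have s: "braid_perm (sgen n i) = transpose i (i + 1)" if "1 \<le> i" "i < n" for i
    using that by (simp add: sgen_def braid_perm_braid)
  have r: "braid_perm (rgen n j) = id" if "1 \<le> j" "j \<le> n" for j
    using that by (simp add: rgen_def braid_perm_braid)
  have one: "\<one>\<^bsub>sym_group n\<^esub> = id" by (simp add: sym_group_def)
  let ?K = "kernel (braid_group n) (sym_group n) braid_perm"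
  show "B.rho_group \<subseteq> ?K"
    unfolding B.rho_group_def using r
    by (intro B.generate_subgroup_incl p.subgroup_kernel) (auto simp: kernel_def one)
  show "?K \<subseteq> B.rho_group"
  proof
    fix x assume x: "x \<in> ?K"
    have "generate (braid_group n) (rgen n ` {1..n} \<union> sgen n ` {1..<n}) = carrier (braid_group n)"
      by (intro braid_group_generated B.generate_is_subgroup) (auto intro!: generate.incl)
    then show "x \<in> B.rho_group"
      using x s r by (intro B.kernel_perm_subset_rho_group[OF braid_perm_hom]) (auto simp: kernel_def one)
  qed
qed

text \<open>
  A product of \<open>\<rho>\<close>'s fixes all strings in the action of \<^const>\<open>swap_points\<close> and
  \<^const>\<open>flip_point\<close>, and each lift is either kept or exchanged. The latter
  information, for the \<open>j\<close>-th string, is the \<open>j\<close>-th homomorphism.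
\<close>

lemma pure_braid_characters:
  assumes n: "2 \<le> n"
  obtains c where "\<And>j. c j \<in> hom (pure_braid_group n) (integer_mod_group 2)"
    "\<And>i j. j \<in> {1..n} \<Longrightarrow> c i (rgen n j) = (if i = j then 1 else 0)"
proof -
  interpret B: projective_braids "braid_group n" n "sgen n" "rgen n"
    by (rule projective_braids_braid_group) fact
  obtain h where h: "h \<in> hom (braid_group n) (BijGroup UNIV)"
    "\<And>i. 1 \<le> i \<Longrightarrow> i < n \<Longrightarrow> h (sgen n i) = swap_points i"
    "\<And>j. 1 \<le> j \<Longrightarrow> j \<le> n \<Longrightarrow> h (rgen n j) = flip_point j"
    by (rule braid_group_hom[OF projective_braids_flips[OF n]]) (rule that)
  interpret h: group_hom "braid_group n" "BijGroup UNIV" h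
    by (intro group_hom.intro group_hom_axioms.intro h(1) group_braid_group group_BijGroup)
  have mult: "h (x \<otimes>\<^bsub>braid_group n\<^esub> y) = h x \<circ> h y"
    if "x \<in> carrier (braid_group n)" "y \<in> carrier (braid_group n)" for x y
    using h.hom_mult[OF that] h.hom_closed[OF that(1)] h.hom_closed[OF that(2)] by simp
  have one: "h \<one>\<^bsub>braid_group n\<^esub> = id" using h.hom_one by simp
  have gens: "rgen n ` {1..n} \<subseteq> carrier (braid_group n)" by auto
  have step: "\<exists>C. \<forall>p e. h (y \<otimes>\<^bsub>braid_group n\<^esub> z) (p, e) = (p, e \<noteq> C p)"
    if y: "y \<in> carrier (braid_group n)" and C: "\<forall>p e. h y (p, e) = (p, e \<noteq> C p)"
      and z: "z \<in> carrier (braid_group n)" "h z = flip_point j" for y z j C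
    unfolding mult[OF y z(1)] z(2)
    by (intro exI[of _ "\<lambda>p. C p \<noteq> (p = j)"]) (auto simp: flip_point_def C)
  have inv: "h (inv\<^bsub>braid_group n\<^esub> rgen n j) = flip_point j" if "1 \<le> j" "j \<le> n" for j
  proof -
    have "h (inv\<^bsub>braid_group n\<^esub> rgen n j) \<circ> flip_point j = id"
      using mult[of "inv\<^bsub>braid_group n\<^esub> rgen n j" "rgen n j"] h(3)[OF that] one by simp
    moreover have "flip_point j \<circ> flip_point j = id"
      by (auto simp: flip_point_def fun_eq_iff)
    ultimately show ?thesis by (metis comp_assoc comp_id id_comp)
  qed
  have flip: "\<exists>C. \<forall>p e. h x (p, e) = (p, e \<noteq> C p)" if "x \<in> B.rho_group" for x
    using that gens unfolding B.rho_group_def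
  proof (induction rule: B.generate_right_induct)
    case one
    show ?case unfolding \<open>h \<one>\<^bsub>braid_group n\<^esub> = id\<close> by (intro exI[of _ "\<lambda>_. False"]) simp
  next
    case (mult y a)
    from mult(3) obtain C where C: "\<forall>p e. h y (p, e) = (p, e \<noteq> C p)" ..
    from mult(2) obtain j where "1 \<le> j" "j \<le> n" "a = rgen n j" by auto
    then show ?case using step[OF mult(1) C, of a j] h(3)[of j] by simp
  next
    case (mult_inv y a)
    from mult_inv(3) obtain C where C: "\<forall>p e. h y (p, e) = (p, e \<noteq> C p)" ..
    from mult_inv(2) obtain j where "1 \<le> j" "j \<le> n" "a = rgen n j" by auto
    then show ?case using step[OF mult_inv(1) C, of "inv\<^bsub>braid_group n\<^esub> a" j] inv[of j] by simp
  qed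
  define c :: "nat \<Rightarrow> braid_gen word set \<Rightarrow> int"
    where "c = (\<lambda>j x. of_bool (snd (h x (j, False))))"
  have R: "carrier (pure_braid_group n) = B.rho_group"
    using pure_braid_group_eq[OF n] by (simp add: pure_braid_group_def)
  show thesis
  proof
    show "c j \<in> hom (pure_braid_group n) (integer_mod_group 2)" for j
    proof (rule homI)
      show "c j x \<in> carrier (integer_mod_group 2)" for x
        by (simp add: c_def carrier_integer_mod_group)
      fix x y assume xy: "x \<in> carrier (pure_braid_group n)" "y \<in> carrier (pure_braid_group n)"
      then obtain C D where C: "\<And>p e. h x (p, e) = (p, e \<noteq> C p)" and D: "\<And>p e. h y (p, e) = (p, e \<noteq> D p)"
        using flip unfolding R by meson
      have "h (x \<otimes>\<^bsub>pure_braid_group n\<^esub> y) = h x \<circ> h y"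
        using xy mult B.rho_group_closed unfolding R by (simp add: pure_braid_group_def)
      then show "c j (x \<otimes>\<^bsub>pure_braid_group n\<^esub> y) = c j x \<otimes>\<^bsub>integer_mod_group 2\<^esub> c j y"
        by (simp add: c_def C D)
    qed
    show "c i (rgen n j) = (if i = j then 1 else 0)" if "j \<in> {1..n}" for i j
      using that h(3)[of j] by (simp add: c_def flip_point_def)
  qed
qed

lemma (in group) int_pow_conj_eq:
  "a \<in> carrier G \<Longrightarrow> a [^] (- int i) \<otimes> b \<otimes> a [^] i = inv (a [^] i) \<otimes> b \<otimes> a [^] i"
  by (simp add: int_pow_neg_int)

lemma elem_a_eq:
  assumes "2 \<le> n"
  shows "elem_a n = projective_braids.rot (braid_group n) (sgen n) (rgen n) n"
proof -
  interpret B: projective_braids "braid_group n" n "sgen n" "rgen n"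
    by (rule projective_braids_braid_group) fact
  obtain m where m: "n = Suc m" "m < n" using assms by (cases n) auto
  have "elem_a n = braid n (rho n) \<otimes>\<^bsub>braid_group n\<^esub> braid n (concat (map sig (rev [1..<Suc m])))"
    unfolding elem_a_def using sig_words(2)[OF m(2)] assms m(1)
    by (subst braid_append) (auto simp del: upt_Suc)
  also have "\<dots> = B.rot n"
    using assms m(1) unfolding braid_descending[OF m(2)] B.rot_def by (simp add: rgen_def)
  finally show ?thesis .
qed

lemma elem_b_eq:
  assumes "2 \<le> n"
  shows "elem_b n = projective_braids.rot (braid_group n) (sgen n) (rgen n) (n - 1)"
proof -
  interpret B: projective_braids "braid_group n" n "sgen n" "rgen n"
    by (rule projective_braids_braid_group) fact
  obtain m where m: "n - 1 = Suc m" "m < n" "Suc m \<le> n" using assms by (cases "n - 1") auto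
  have "elem_b n = braid n (rho (Suc m)) \<otimes>\<^bsub>braid_group n\<^esub> braid n (concat (map sig (rev [1..<Suc m])))"
    unfolding elem_b_def m(1) using sig_words(2)[OF m(2)] m(3)
    by (subst braid_append) (auto simp del: upt_Suc)
  also have "\<dots> = B.rot (Suc m)"
    using m(3) unfolding braid_descending[OF m(2)] B.rot_def by (simp add: rgen_def)
  finally show ?thesis using m(1) by simp
qed

theorem theorem6:
  fixes n :: nat
  assumes "2 \<le> n"
  defines "B \<equiv> braid_group n"
    and "P \<equiv> pure_braid_group n"
    and "a \<equiv> elem_a n"
    and "b \<equiv> elem_b n"
  defines "Y \<equiv> insert (a [^]\<^bsub>B\<^esub> n)
      ((\<lambda>i::nat. a [^]\<^bsub>B\<^esub> (- int i) \<otimes>\<^bsub>B\<^esub> b [^]\<^bsub>B\<^esub> (n - 1) \<otimes>\<^bsub>B\<^esub> a [^]\<^bsub>B\<^esub> i) ` {0..n - 2})"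
  shows "(generated_by B {a, b} \<and> G_rank B = 2 \<and> TG_rank B = 2)
    \<and> ((\<forall>x\<in>carrier B. subgroup (normal_closure B {x}) B \<and> normal_closure B {x} \<subset> carrier B)
       \<and> NG_rank B = 2 \<and> NTG_rank B = 2
       \<and> (\<forall>k. \<not> strongly_torsion_generated k B))
    \<and> (B Mod normal_closure B {a} \<cong> integer_mod_group 2
       \<and> B Mod normal_closure B {b} \<cong> integer_mod_group 2)
    \<and> (torsion_generated_by P Y \<and> (\<forall>y\<in>Y. group.ord P y = 4)
       \<and> G_rank P = enat n \<and> NG_rank P = enat n \<and> TG_rank P = enat n \<and> NTG_rank P = enat n
       \<and> (\<forall>A. A \<subseteq> carrier P \<and> finite A \<and> card A < n \<longrightarrow> \<not> normally_generated_by P A))"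
proof -
  interpret B: projective_braids B n "sgen n" "rgen n"
    unfolding B_def by (rule projective_braids_braid_group) fact
  have ab: "a = B.rot n" "b = B.rot (n - 1)"
    using elem_a_eq elem_b_eq assms(1) by (simp_all add: a_def b_def B_def)
  have abc [simp]: "a \<in> carrier B" "b \<in> carrier B" by (simp_all add: ab)
  let ?z = "B.W \<otimes>\<^bsub>B\<^esub> B.W"
  have z: "?z \<noteq> \<one>\<^bsub>B\<^esub>"
    using braid_full_twist_nontrivial[OF assms(1)] B.rot_pow_self[of n] assms(1) by (simp add: B_def)
  have Y: "Y = insert B.W (B.torsion_gen ` {0..n - 2})"
    unfolding Y_def ab B.torsion_gen_def by (simp only: B.int_pow_conj_eq B.rot_closed)
  have gen: "generated_by B {a, b}"
  proof -
    have "subgroup (generate B {a, b}) B" by (intro B.generate_is_subgroup) auto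
    moreover have "a \<in> generate B {a, b}" "b \<in> generate B {a, b}"
      by (auto intro: generate.incl)
    ultimately have "generate B {a, b} = carrier B"
      using B.generators_in_subgroup[of "generate B {a, b}"] unfolding ab B_def
      by (intro braid_group_generated) auto
    then show ?thesis by (simp add: generated_by_def)
  qed
  have tors: "torsion_set B {a, b}"
  proof -
    have pos: "0 < B.ord x" if "x \<in> carrier B" "1 \<le> k" "x [^]\<^bsub>B\<^esub> k \<otimes>\<^bsub>B\<^esub> x [^]\<^bsub>B\<^esub> k = ?z" for x and k :: nat
    proof -
      have "x [^]\<^bsub>B\<^esub> (k + k + (k + k)) = \<one>\<^bsub>B\<^esub>"
        using that B.W_W_square by (simp add: B.nat_pow_mult[symmetric])
      then have "B.ord x dvd (k + k + (k + k))" using that B.pow_eq_id by simp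
      then show ?thesis using that(2) by (intro Nat.gr0I) auto
    qed
    have "0 < B.ord a" using pos[of a n] assms(1) by (simp add: ab)
    moreover have "0 < B.ord b"
      using pos[of b "n - 1"] assms(1) B.rot_pred_pow_square by (simp add: ab)
    ultimately show ?thesis by (simp add: torsion_set_def)
  qed
  have lowerB: "2 \<le> card A" if "finite A" "normally_generated_by B A" for A
  proof -
    obtain \<chi> where \<chi>: "\<chi> \<in> hom B (integer_mod_group 2)"
      "\<And>i. 1 \<le> i \<Longrightarrow> i < n \<Longrightarrow> \<chi> (sgen n i) = 1" "\<And>j. 1 \<le> j \<Longrightarrow> j \<le> n \<Longrightarrow> \<chi> (rgen n j) = 0"
      unfolding B_def by (rule braid_group_characters[OF assms(1), of 1 0]) (auto intro: that)
    obtain \<psi> where \<psi>: "\<psi> \<in> hom B (integer_mod_group 2)"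
      "\<And>i. 1 \<le> i \<Longrightarrow> i < n \<Longrightarrow> \<psi> (sgen n i) = 0" "\<And>j. 1 \<le> j \<Longrightarrow> j \<le> n \<Longrightarrow> \<psi> (rgen n j) = 1"
      unfolding B_def by (rule braid_group_characters[OF assms(1), of 0 1]) (auto intro: that)
    have "card (UNIV :: bool set) \<le> card A"
    proof (rule B.card_normal_generators_ge)
      show "(if j then \<chi> else \<psi>) \<in> hom B (integer_mod_group 2)" for j using \<chi> \<psi> by simp
      show "(if j then sgen n 1 else rgen n 1) \<in> carrier B" for j by simp
      show "(if i then \<chi> else \<psi>) (if j then sgen n 1 else rgen n 1) = (if i = j then 1 else 0)" for i j
        using \<chi>(2,3)[of 1] \<psi>(2,3)[of 1] assms(1) by auto
    qed (use that in auto)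
    then show ?thesis by simp
  qed
  have gen_norm: "normally_generated_by B A" if "generated_by B A" for A
    using that by (rule B.generated_imp_normally_generated)
  have card_ab: "card {a, b} \<le> 2" by (simp add: card_insert_if)
  have ranksB: "G_rank B = 2" "TG_rank B = 2" "NG_rank B = 2" "NTG_rank B = 2"
    unfolding G_rank_def TG_rank_def NG_rank_def NTG_rank_def numeral_eq_enat
    by (rule min_card_eq[where A = "{a, b}"];
        use gen tors gen_norm lowerB card_ab in \<open>auto simp: torsion_generated_by_def\<close>)+
  have single: "subgroup (normal_closure B {x}) B \<and> normal_closure B {x} \<subset> carrier B"
    if "x \<in> carrier B" for x
  proof -
    have sub: "subgroup (normal_closure B {x}) B"
      using that by (intro normal_imp_subgroup B.normal_normal_closure) auto
    have "\<not> normally_generated_by B {x}" using lowerB[of "{x}"] by auto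
    then have "normal_closure B {x} \<noteq> carrier B" using that by (simp add: normally_generated_by_def)
    with sub show ?thesis using subgroup.subset by blast
  qed
  have strong: "\<not> strongly_torsion_generated k B" for k
    using single by (auto simp: strongly_torsion_generated_def)
  have quot: "B Mod normal_closure B {a} \<cong> integer_mod_group 2"
    "B Mod normal_closure B {b} \<cong> integer_mod_group 2"
  proof -
    have m: "int ((n - 1) mod 2) \<in> {0, 1}" "int (n mod 2) \<in> {0, 1}" by auto
    \<comment> \<open>With \<open>\<sigma> \<mapsto> 1\<close> and \<open>\<rho> \<mapsto> n - 1\<close> the element \<open>a\<close> goes to \<open>2 (n - 1)\<close> and \<open>b\<close> to
      \<open>2 n - 3\<close>; with \<open>\<rho> \<mapsto> n\<close> the parities are exchanged.\<close>
    have even: "(int (k mod 2) + int k) mod 2 = 0" for k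
      by (simp add: zmod_int mod_simps flip: mult_2)
    have odd: "(int (Suc k mod 2) + int k) mod 2 = 1" for k
    proof -
      have "(int (Suc k mod 2) + int k) mod 2 = (2 * int k + 1) mod 2"
        by (simp add: zmod_int mod_simps algebra_simps)
      then show ?thesis by presburger
    qed
    have n: "Suc (n - 1) = n" "Suc (n - 2) = n - 1" "n mod 2 = (n - 2) mod 2"
      "1 \<le> n - 1" "n - 1 - 1 = n - 2"
      using assms(1) le_mod_geq[of 2 n] by auto
    obtain \<chi> where \<chi>: "\<chi> \<in> hom B (integer_mod_group 2)"
      "\<And>m. 1 \<le> m \<Longrightarrow> m \<le> n \<Longrightarrow> \<chi> (B.rot m) = (int ((n - 1) mod 2) + int (m - 1) * 1) mod 2"
      unfolding B_def by (rule braid_group_characters[OF assms(1) _ m(1), of 1]) (auto intro: that)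
    have "\<chi> a = 0"
      unfolding ab using \<chi>(2)[of n] even[of "n - 1"] assms(1) by simp
    moreover have "\<chi> b = 1"
      unfolding ab using \<chi>(2)[of "n - 1"] odd[of "n - 2"] by (simp only: n) simp
    ultimately show "B Mod normal_closure B {a} \<cong> integer_mod_group 2"
      using gen \<chi>(1) B.rot_pred_square_in_normal_closure unfolding ab
      by (intro B.FactGroup_iso_Z2)
    obtain \<psi> where \<psi>: "\<psi> \<in> hom B (integer_mod_group 2)"
      "\<And>m. 1 \<le> m \<Longrightarrow> m \<le> n \<Longrightarrow> \<psi> (B.rot m) = (int (n mod 2) + int (m - 1) * 1) mod 2"
      unfolding B_def by (rule braid_group_characters[OF assms(1) _ m(2), of 1]) (auto intro: that)
    have "\<psi> b = 0"
      unfolding ab using \<psi>(2)[of "n - 1"] even[of "n - 2"] by (simp only: n) simp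
    moreover have "\<psi> a = 1"
      unfolding ab using \<psi>(2)[of n] odd[of "n - 1"] assms(1) by (simp add: n(1))
    moreover have "generated_by B {b, a}" using gen by (simp add: insert_commute)
    ultimately show "B Mod normal_closure B {b} \<cong> integer_mod_group 2"
      using \<psi>(1) B.rot_square_in_normal_closure unfolding ab
      by (intro B.FactGroup_iso_Z2)
  qed
  have P: "P = B\<lparr>carrier := B.rho_group\<rparr>"
    unfolding P_def pure_braid_group_def pure_braid_group_eq[OF assms(1)] B_def ..
  interpret P: group P
    unfolding P using B.subgroup_rho_group B.group_axioms by (rule subgroup.subgroup_is_group)
  have carP: "carrier P = B.rho_group" by (simp add: P)
  have YR: "Y \<subseteq> B.rho_group"
    unfolding Y using B.W_in_rho_group B.torsion_gen_in_rho_group by auto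
  have genP: "generated_by P Y"
  proof -
    have "generate P Y = generate B Y"
      unfolding P by (rule B.generate_consistent[OF YR B.subgroup_rho_group])
    moreover have "generate B Y \<subseteq> B.rho_group" by (rule B.generate_subgroup_incl[OF YR B.subgroup_rho_group])
    moreover have "B.rho_group \<subseteq> generate B Y"
    proof -
      have sub: "subgroup (generate B Y) B"
        using YR B.rho_group_closed by (intro B.generate_is_subgroup) auto
      have "rgen n j \<in> generate B Y" if "1 \<le> j" "j \<le> n" for j
        by (rule B.r_in_subgroup[OF sub _ _ that]) (auto simp: Y intro: generate.incl)
      then show ?thesis unfolding B.rho_group_def
        by (intro B.generate_subgroup_incl[OF _ sub]) auto
    qed
    ultimately show ?thesis using YR by (simp add: generated_by_def carP)
  qed
  have ord: "P.ord y = 4" if "y \<in> Y" for y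
  proof -
    have "y \<otimes>\<^bsub>B\<^esub> y = ?z" using that B.torsion_gen_square unfolding Y by auto
    then show ?thesis
      using that YR B.W_W_square z by (intro P.ord_eq_4I) (auto simp: P)
  qed
  have torsP: "torsion_set P Y" unfolding torsion_set_def using ord by simp
  have finY: "finite Y" by (simp add: Y)
  have cardY: "card Y \<le> n"
  proof -
    have "card Y \<le> Suc (card (B.torsion_gen ` {0..n - 2}))" unfolding Y by (simp add: card_insert_if)
    also have "\<dots> \<le> Suc (card {0..n - 2})" by (intro Suc_le_mono[THEN iffD2] card_image_le) simp
    finally show ?thesis using assms(1) by simp
  qed
  have lowerP: "n \<le> card A" if A: "finite A" "normally_generated_by P A" for A
  proof -
    obtain c where c: "\<And>j. c j \<in> hom (pure_braid_group n) (integer_mod_group 2)"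
      "\<And>i j. j \<in> {1..n} \<Longrightarrow> c i (rgen n j) = (if i = j then 1 else 0)"
      by (rule pure_braid_characters[OF assms(1)]) (rule that)
    have "card {1..n} \<le> card A"
      using c(1)[folded P_def] c(2) A B.r_in_rho_group by (intro P.card_normal_generators_ge[of "{1..n}" c "rgen n"]) (auto simp: carP)
    then show ?thesis by simp
  qed
  have gen_normP: "normally_generated_by P A" if "generated_by P A" for A
    using that by (rule P.generated_imp_normally_generated)
  \<comment> \<open>All four ranks lie between the bound for normal generation and the size of \<open>Y\<close>.\<close>
  have ranksP: "G_rank P = enat n" "NG_rank P = enat n" "TG_rank P = enat n" "NTG_rank P = enat n"
    unfolding G_rank_def TG_rank_def NG_rank_def NTG_rank_def
    by (rule min_card_eq[where A = Y];
        use genP torsP gen_normP lowerP cardY finY in \<open>auto simp: torsion_generated_by_def\<close>)+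
  have lowP: "\<not> normally_generated_by P A" if "finite A" "card A < n" for A
    using lowerP[of A] that by auto
  have "torsion_generated_by P Y" using genP torsP by (simp add: torsion_generated_by_def)
  with gen ranksB single strong quot ord ranksP lowP show ?thesis by blast
qed

end
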